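(* Let $n\geq 0$ and let $x_1,\dots,x_n\in 2^\omega$ be distinct points of the Cantor space. Then the pointwise stabiliser $(\mathrm{Homeo}\,2^\omega)_{(x_1,\dots,x_n)}=\{g\in\mathrm{Homeo}\,2^\omega: g(x_i)=x_i\ \forall i\in[n]\}$ has ample generics.
   Context: $\mathrm{Homeo}\,2^\omega$ is the group of homeomorphisms of the Cantor space, with its standard Polish topology (the compact-open topology, equivalently the topology of pointwise convergence of its action on the clopen subsets of $2^\omega$); the stabiliser carries the subspace topology. For a topological group $G$ and $m\in\mathbb{N}$, $G$ acts on $G^m$ by diagonal conjugation $(h_1,\dots,h_m)^g=(g^{-1}h_1g,\dots,g^{-1}h_mg)$; a tuple is generic if its orbit is comeagre in $G^m$; $G$ has ample generics if it has generic $m$-tuples for all $m\in\mathbb{N}$. $[n]=\{1,\dots,n\}$. *)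

theory Defs
  imports "HOL-Analysis.Analysis"
begin

definition cantor_top :: "(nat \<Rightarrow> bool) topology" where
  "cantor_top = product_topology (\<lambda>_. discrete_topology (UNIV :: bool set)) (UNIV :: nat set)"

definition clopen_cantor :: "(nat \<Rightarrow> bool) set \<Rightarrow> bool" where
  "clopen_cantor C \<longleftrightarrow> openin cantor_top C \<and> closedin cantor_top C"

definition Homeo :: "((nat \<Rightarrow> bool) \<Rightarrow> (nat \<Rightarrow> bool)) set" where
  "Homeo = {f. homeomorphic_map cantor_top cantor_top f}"

text \<open>Its Polish topology: pointwise convergence of the action on clopen sets, i.e.
  generated by the sets of homeomorphisms mapping a clopen set C onto a clopen set D.\<close>
definition Homeo_top :: "((nat \<Rightarrow> bool) \<Rightarrow> (nat \<Rightarrow> bool)) topology" where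
  "Homeo_top = subtopology
     (topology_generated_by {{g. g ` C = D} | C D. clopen_cantor C \<and> clopen_cantor D}) Homeo"

definition Stab :: "nat \<Rightarrow> (nat \<Rightarrow> (nat \<Rightarrow> bool)) \<Rightarrow> ((nat \<Rightarrow> bool) \<Rightarrow> (nat \<Rightarrow> bool)) set" where
  "Stab n x = {g \<in> Homeo. \<forall>i\<in>{1..n}. g (x i) = x i}"

definition Stab_top :: "nat \<Rightarrow> (nat \<Rightarrow> (nat \<Rightarrow> bool)) \<Rightarrow> ((nat \<Rightarrow> bool) \<Rightarrow> (nat \<Rightarrow> bool)) topology" where
  "Stab_top n x = subtopology Homeo_top (Stab n x)"

definition nowhere_dense_in :: "'a topology \<Rightarrow> 'a set \<Rightarrow> bool" where
  "nowhere_dense_in X S \<longleftrightarrow> S \<subseteq> topspace X \<and> X interior_of (X closure_of S) = {}"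

definition meagre_in :: "'a topology \<Rightarrow> 'a set \<Rightarrow> bool" where
  "meagre_in X S \<longleftrightarrow> S \<subseteq> topspace X \<and>
     (\<exists>N :: nat \<Rightarrow> 'a set. (\<forall>k. nowhere_dense_in X (N k)) \<and> S \<subseteq> (\<Union>k. N k))"

definition comeagre_in :: "'a topology \<Rightarrow> 'a set \<Rightarrow> bool" where
  "comeagre_in X S \<longleftrightarrow> S \<subseteq> topspace X \<and> meagre_in X (topspace X - S)"

text \<open>For a group G of permutations of a type (operation composition, topology T with
  topspace G), m-tuples are elements of G^m indexed by {..<m}, with the product topology;
  G acts by diagonal conjugation.\<close>
definition conj_orbit :: "('b \<Rightarrow> 'b) set \<Rightarrow> nat \<Rightarrow> (nat \<Rightarrow> 'b \<Rightarrow> 'b) \<Rightarrow> (nat \<Rightarrow> 'b \<Rightarrow> 'b) set" where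
  "conj_orbit G m h = {(\<lambda>i\<in>{..<m}. inv g \<circ> h i \<circ> g) | g. g \<in> G}"

definition generic_tuple :: "('b \<Rightarrow> 'b) set \<Rightarrow> ('b \<Rightarrow> 'b) topology \<Rightarrow> nat \<Rightarrow> (nat \<Rightarrow> 'b \<Rightarrow> 'b) \<Rightarrow> bool" where
  "generic_tuple G T m h \<longleftrightarrow>
     h \<in> topspace (product_topology (\<lambda>_. T) {..<m}) \<and>
     comeagre_in (product_topology (\<lambda>_. T) {..<m}) (conj_orbit G m h)"

definition ample_generics :: "('b \<Rightarrow> 'b) set \<Rightarrow> ('b \<Rightarrow> 'b) topology \<Rightarrow> bool" where
  "ample_generics G T \<longleftrightarrow> (\<forall>m::nat. \<exists>h. generic_tuple G T m h)"

end

theory Submission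
  imports Defs
begin

text \<open>
  A tuple of homeomorphisms and a finite clopen partition induce a finite labelled graph on the
  cells: \<open>m\<close> relations, total and surjective, with loops at the cells of the fixed points. Every
  such graph is covered by a \<^emph>\<open>branching\<close> one, in which a vertex has a unique neighbour in all
  directions but possibly one, the direction towards the place from which it was entered. Over a
  branching graph any two finer graphs can be amalgamated: starting anywhere and walking away
  from the exempt direction, the two labellings of the tree of the free group are forced to agree.

  Hence two kinds of conditions are open and dense: every partition has a refinement
  with branching graph, and every partition with branching graph can be refined so as to
  realise any prescribed finer graph. There are countably many of them, and any two tuples
  satisfying them all are conjugate by a back-and-forth construction of matching partitions.
\<close>

section \<open>Prefixes and locally constant functions on the Cantor space\<close>

type_synonym cantor = "nat \<Rightarrow> bool"

definition determines :: "('a \<Rightarrow> 'b) \<Rightarrow> ('a \<Rightarrow> 'c) \<Rightarrow> bool" where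
  "determines u v \<longleftrightarrow> (\<forall>y z. u y = u z \<longrightarrow> v y = v z)"

definition prefix_of :: "nat \<Rightarrow> cantor \<Rightarrow> bool list" where
  "prefix_of k y = map y [0..<k]"

definition locally_const :: "(cantor \<Rightarrow> 'a) \<Rightarrow> bool" where
  "locally_const \<rho> \<longleftrightarrow> (\<exists>k. determines (prefix_of k) \<rho>)"

lemma determinesD: "determines u v \<Longrightarrow> u y = u z \<Longrightarrow> v y = v z"
  unfolding determines_def by blast

lemma determines_iff_factor: "determines u v \<longleftrightarrow> (\<exists>f. v = f \<circ> u)"
  unfolding determines_def by (rule function_factors_left)

lemma determines_comp: "determines u (f \<circ> u)"
  by (simp add: determines_def)

lemma determinesI: "v = f \<circ> u \<Longrightarrow> determines u v"
  by (simp add: determines_comp)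

lemma determines_refl: "determines u u"
  by (simp add: determines_def)

lemma determines_pair: "determines u v \<Longrightarrow> determines u w \<Longrightarrow> determines u (\<lambda>y. (v y, w y))"
  unfolding determines_def by blast

lemma determines_trans: "determines u v \<Longrightarrow> determines v w \<Longrightarrow> determines u w"
  unfolding determines_def by blast

lemma prefix_of_eq_iff: "prefix_of k y = prefix_of k z \<longleftrightarrow> (\<forall>i<k. y i = z i)"
  by (auto simp: prefix_of_def)

lemma determines_prefix_of: "k \<le> l \<Longrightarrow> determines (prefix_of l) (prefix_of k)"
  by (auto simp: determines_def prefix_of_eq_iff)

lemma eq_if_prefixes_eq: "(\<And>k. prefix_of k y = prefix_of k z) \<Longrightarrow> y = z"
  by (auto simp: prefix_of_eq_iff)

lemma finite_range_prefix_of: "finite (range (prefix_of k))"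
proof (rule finite_subset)
  show "range (prefix_of k) \<subseteq> {xs. set xs \<subseteq> UNIV \<and> length xs = k}"
    by (auto simp: prefix_of_def)
qed (rule finite_lists_length_eq, simp)

lemma eventually_determines_prefix_of:
  "locally_const \<rho> \<Longrightarrow> \<forall>\<^sub>F k in sequentially. determines (prefix_of k) \<rho>"
  unfolding locally_const_def eventually_sequentially
  using determines_prefix_of determines_trans by blast

lemma locally_const_prefix_of: "locally_const (prefix_of k)"
  unfolding locally_const_def using determines_prefix_of by blast

lemma locally_const_const: "locally_const (\<lambda>_. c)"
  by (simp add: locally_const_def determines_def)

lemma locally_const_comp: "locally_const \<rho> \<Longrightarrow> locally_const (f \<circ> \<rho>)"
  unfolding locally_const_def using determines_comp determines_trans by blast

lemma common_determining_prefix: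
  assumes "locally_const \<rho>" "locally_const \<sigma>"
  obtains k where "determines (prefix_of k) \<rho>" "determines (prefix_of k) \<sigma>"
  using eventually_conj[OF assms[THEN eventually_determines_prefix_of]]
  by (auto simp: eventually_sequentially)

lemma locally_const_pair:
  assumes "locally_const \<rho>" "locally_const \<sigma>"
  shows "locally_const (\<lambda>y. (\<rho> y, \<sigma> y))"
proof -
  obtain k where "determines (prefix_of k) \<rho>" "determines (prefix_of k) \<sigma>"
    using common_determining_prefix[OF assms] .
  then have "determines (prefix_of k) (\<lambda>y. (\<rho> y, \<sigma> y))"
    by (rule determines_pair)
  then show ?thesis
    by (auto simp: locally_const_def)
qed

lemma finite_range_locally_const:
  assumes "locally_const \<rho>"
  shows "finite (range \<rho>)"
proof -
  obtain k f where "\<rho> = f \<circ> prefix_of k"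
    using assms by (auto simp: locally_const_def determines_iff_factor)
  then have "range \<rho> = f ` range (prefix_of k)"
    by (simp add: image_comp)
  then show ?thesis
    using finite_range_prefix_of by simp
qed

lemma countable_locally_const: "countable {\<rho> :: cantor \<Rightarrow> 'a :: countable. locally_const \<rho>}"
proof -
  have "countable {\<rho> :: cantor \<Rightarrow> 'a. determines (prefix_of k) \<rho>}" for k
  proof -
    let ?W = "range (prefix_of k)"
    have "{\<rho> :: cantor \<Rightarrow> 'a. determines (prefix_of k) \<rho>} \<subseteq> (\<lambda>f. f \<circ> prefix_of k) ` (?W \<rightarrow>\<^sub>E UNIV)"
    proof
      fix \<rho> :: "cantor \<Rightarrow> 'a" assume "\<rho> \<in> {\<rho>. determines (prefix_of k) \<rho>}"
      then obtain f where "\<rho> = f \<circ> prefix_of k"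
        by (auto simp: determines_iff_factor)
      then have "\<rho> = restrict f ?W \<circ> prefix_of k"
        by auto
      then show "\<rho> \<in> (\<lambda>f. f \<circ> prefix_of k) ` (?W \<rightarrow>\<^sub>E UNIV)"
        by (intro image_eqI) auto
    qed
    moreover have "countable (?W \<rightarrow>\<^sub>E (UNIV :: 'a set))"
      by (intro countable_PiE finite_range_prefix_of) simp
    ultimately show ?thesis
      by (rule countable_subset[OF _ countable_image])
  qed
  then have "countable (\<Union>k. {\<rho> :: cantor \<Rightarrow> 'a. determines (prefix_of k) \<rho>})"
    by (intro countable_UN) auto
  then show ?thesis
    by (simp add: locally_const_def Collect_ex_eq)
qed

lemma topspace_cantor [simp]: "topspace cantor_top = UNIV"
  by (simp add: cantor_top_def)

lemma compact_space_cantor: "compact_space cantor_top"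
  unfolding cantor_top_def
  by (simp add: compact_space_product_topology compact_space_discrete_topology)

lemma openin_cantor_cylinder: "openin cantor_top {z. prefix_of k z = prefix_of k y}"
proof -
  define U where "U = (\<lambda>i. if i < k then {y i} else UNIV)"
  have "{i. U i \<noteq> UNIV} \<subseteq> {..<k}"
    by (auto simp: U_def)
  then have "finite {i. U i \<noteq> topspace (discrete_topology UNIV)}"
    using finite_subset by auto
  then have "openin cantor_top (Pi\<^sub>E UNIV U)"
    unfolding cantor_top_def by (intro product_topology_basis) auto
  moreover have "Pi\<^sub>E UNIV U = {z. prefix_of k z = prefix_of k y}"
    by (auto simp: U_def PiE_iff prefix_of_eq_iff split: if_splits)
  ultimately show ?thesis
    by simp
qed

lemma openin_cantor_imp_cylinder:
  assumes "openin cantor_top S" "y \<in> S"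
  shows "\<exists>k. {z. prefix_of k z = prefix_of k y} \<subseteq> S"
proof -
  obtain U where U: "finite {i. U i \<noteq> (UNIV :: bool set)}" "y \<in> Pi\<^sub>E UNIV U" "Pi\<^sub>E UNIV U \<subseteq> S"
    using assms unfolding cantor_top_def openin_product_topology_alt by force
  obtain k where k: "\<And>i. U i \<noteq> UNIV \<Longrightarrow> i < k"
    using finite_nat_set_iff_bounded U(1) by auto
  have "z \<in> Pi\<^sub>E UNIV U" if "prefix_of k z = prefix_of k y" for z
  proof -
    have "z i \<in> U i" for i
      using that U(2) k[of i] by (cases "i < k") (auto simp: prefix_of_eq_iff PiE_iff)
    then show ?thesis
      by (simp add: PiE_iff)
  qed
  then show ?thesis
    using U(3) by blast
qed

lemma openin_cantor_iff:
  "openin cantor_top S \<longleftrightarrow> (\<forall>y\<in>S. \<exists>k. {z. prefix_of k z = prefix_of k y} \<subseteq> S)"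
proof
  assume S: "\<forall>y\<in>S. \<exists>k. {z. prefix_of k z = prefix_of k y} \<subseteq> S"
  show "openin cantor_top S"
  proof (subst openin_subopen, intro ballI)
    fix y assume "y \<in> S"
    then obtain k where "{z. prefix_of k z = prefix_of k y} \<subseteq> S"
      using S by blast
    then show "\<exists>T. openin cantor_top T \<and> y \<in> T \<and> T \<subseteq> S"
      using openin_cantor_cylinder by blast
  qed
qed (blast intro: openin_cantor_imp_cylinder)

lemma locally_const_if_continuous_map:
  assumes "continuous_map cantor_top (discrete_topology UNIV) \<rho>"
  shows "locally_const \<rho>"
proof -
  define W where "W k = {y. \<exists>a. {z. prefix_of k z = prefix_of k y} \<subseteq> \<rho> -` {a}}" for k
  have "openin cantor_top (W k)" for k
    unfolding openin_cantor_iff W_def by (intro ballI exI[of _ k]) (auto, blast)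
  moreover have "topspace cantor_top \<subseteq> \<Union> (range W)"
  proof
    fix y
    have "openin cantor_top (\<rho> -` {\<rho> y})"
      using openin_continuous_map_preimage[OF assms, of "{\<rho> y}"] by (simp add: vimage_def)
    then have "\<exists>k. {z. prefix_of k z = prefix_of k y} \<subseteq> \<rho> -` {\<rho> y}"
      by (rule openin_cantor_imp_cylinder) simp
    then show "y \<in> \<Union> (range W)"
      unfolding W_def by blast
  qed
  ultimately have "\<exists>\<W>. finite \<W> \<and> \<W> \<subseteq> range W \<and> topspace cantor_top \<subseteq> \<Union>\<W>"
    using compact_space_cantor[unfolded compact_space_alt, THEN spec, of "range W"]
    by (simp del: topspace_cantor)
  then obtain K where K: "finite K" "UNIV \<subseteq> (\<Union>k\<in>K. W k)"
    by (metis finite_subset_image topspace_cantor)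
  have "\<rho> z = \<rho> y" if "prefix_of (Max K) z = prefix_of (Max K) y" for y z
  proof -
    obtain k where k: "k \<in> K" "y \<in> W k"
      using K(2) by blast
    have "prefix_of k z = prefix_of k y"
      using that by (rule determinesD[OF determines_prefix_of[OF Max_ge[OF K(1) k(1)]]])
    then show ?thesis
      using k(2) by (auto simp: W_def)
  qed
  then have "determines (prefix_of (Max K)) \<rho>"
    unfolding determines_def by blast
  then show ?thesis
    by (auto simp: locally_const_def)
qed

lemma continuous_map_if_locally_const:
  assumes "locally_const \<rho>"
  shows "continuous_map cantor_top (discrete_topology UNIV) \<rho>"
  unfolding continuous_map_alt
proof (intro conjI allI impI)
  obtain k f where "\<rho> = f \<circ> prefix_of k"
    using assms by (auto simp: locally_const_def determines_iff_factor)
  show "openin cantor_top (\<rho> -` U \<inter> topspace cantor_top)" for U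
    unfolding openin_cantor_iff \<open>\<rho> = f \<circ> prefix_of k\<close> by (intro ballI exI[of _ k]) auto
qed auto

lemma locally_const_iff_continuous_map:
  "locally_const \<rho> \<longleftrightarrow> continuous_map cantor_top (discrete_topology UNIV) \<rho>"
  using locally_const_if_continuous_map continuous_map_if_locally_const by blast

lemma clopen_cantor_iff_locally_const: "clopen_cantor C \<longleftrightarrow> locally_const (\<lambda>y. y \<in> C)"
proof
  assume "clopen_cantor C"
  then have "openin cantor_top C" "openin cantor_top (- C)"
    by (auto simp: clopen_cantor_def closedin_def Compl_eq_Diff_UNIV)
  moreover have "{y. (y \<in> C) \<in> U} =
      (if True \<in> U then C else {}) \<union> (if False \<in> U then - C else {})" for U
    by (intro set_eqI) (simp, metis (full_types))
  ultimately have "openin cantor_top {y. (y \<in> C) \<in> U}" for U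
    using openin_topspace[of cantor_top] by auto
  then show "locally_const (\<lambda>y. y \<in> C)"
    unfolding locally_const_iff_continuous_map by (auto simp: continuous_map_def)
next
  assume "locally_const (\<lambda>y. y \<in> C)"
  then have preimage_open: "openin cantor_top {y. (y \<in> C) \<in> U}" for U
    using openin_continuous_map_preimage[of cantor_top "discrete_topology UNIV" "\<lambda>y. y \<in> C" U]
    by (simp add: locally_const_iff_continuous_map)
  show "clopen_cantor C"
    using preimage_open[of "{True}"] preimage_open[of "{False}"]
    by (simp add: clopen_cantor_def closedin_def Collect_neg_eq flip: Compl_eq_Diff_UNIV)
qed

lemma continuous_map_cantorI:
  assumes "\<And>k. locally_const (prefix_of k \<circ> g)"
  shows "continuous_map cantor_top cantor_top g"
proof -
  have "locally_const (\<lambda>y. g y i)" for i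
  proof -
    have "(\<lambda>y. g y i) = (\<lambda>w. w ! i) \<circ> (prefix_of (Suc i) \<circ> g)"
      by (auto simp: prefix_of_def nth_append)
    then show ?thesis
      using locally_const_comp[OF assms] by metis
  qed
  then have "continuous_map cantor_top (discrete_topology UNIV) (\<lambda>y. g y i)" for i
    by (simp add: locally_const_iff_continuous_map)
  then show ?thesis
    by (simp add: cantor_top_def continuous_map_componentwise_UNIV)
qed

section \<open>The homeomorphism group and its topology\<close>

lemma bij_if_Homeo: "g \<in> Homeo \<Longrightarrow> bij g"
  unfolding Homeo_def by (auto simp: homeomorphic_eq_everything_map bij_def)

lemma locally_const_comp_Homeo:
  assumes "locally_const \<rho>" "g \<in> Homeo"
  shows "locally_const (\<rho> \<circ> g)"
  using assms homeomorphic_imp_continuous_map continuous_map_compose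
  unfolding locally_const_iff_continuous_map Homeo_def mem_Collect_eq by metis

lemma HomeoI:
  assumes "f \<circ> g = id" "g \<circ> f = id"
    and "\<And>k. locally_const (prefix_of k \<circ> f)" "\<And>k. locally_const (prefix_of k \<circ> g)"
  shows "f \<in> Homeo"
proof -
  have "homeomorphic_maps cantor_top cantor_top f g"
    unfolding homeomorphic_maps_def
    using assms by (simp add: continuous_map_cantorI pointfree_idE)
  then show ?thesis
    unfolding Homeo_def using homeomorphic_map_maps by blast
qed

lemma Homeo_id: "id \<in> Homeo"
  by (simp add: HomeoI locally_const_prefix_of)

lemma Homeo_comp: "f \<in> Homeo \<Longrightarrow> g \<in> Homeo \<Longrightarrow> f \<circ> g \<in> Homeo"
  unfolding Homeo_def using homeomorphic_map_compose by blast

lemma Homeo_inv: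
  assumes "g \<in> Homeo"
  shows "inv g \<in> Homeo"
proof -
  obtain f where f: "homeomorphic_maps cantor_top cantor_top g f"
    using assms by (auto simp: Homeo_def homeomorphic_map_maps)
  have "inv g = f"
    by (rule inv_equality) (use f in \<open>auto simp: homeomorphic_maps_def\<close>)
  moreover have "homeomorphic_map cantor_top cantor_top f"
    using f homeomorphic_maps_sym homeomorphic_map_maps by blast
  ultimately show ?thesis
    by (simp add: Homeo_def)
qed

lemma topspace_Homeo_top: "topspace Homeo_top = Homeo"
proof -
  have "clopen_cantor UNIV"
    by (simp add: clopen_cantor_iff_locally_const locally_const_const)
  then have "g \<in> topspace
      (topology_generated_by {{g. g ` C = D} | C D. clopen_cantor C \<and> clopen_cantor D})"
    if "g \<in> Homeo" for g
    using bij_if_Homeo[OF that] by (auto simp: topology_generated_by_topspace bij_def)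
  then show ?thesis
    unfolding Homeo_top_def by auto
qed

definition homeo_ball :: "nat \<Rightarrow> (cantor \<Rightarrow> cantor) \<Rightarrow> (cantor \<Rightarrow> cantor) set" where
  "homeo_ball k g = {g' \<in> Homeo. prefix_of k \<circ> g' = prefix_of k \<circ> g}"

lemma comp_eq_if_homeo_ball:
  assumes "g' \<in> homeo_ball k g" "determines (prefix_of k) \<rho>"
  shows "\<rho> \<circ> g' = \<rho> \<circ> g"
  using assms by (auto simp: homeo_ball_def determines_iff_factor comp_assoc)

lemma bij_image_eq_iff: "bij g \<Longrightarrow> g ` C = D \<longleftrightarrow> C = g -` D"
  by (metis bij_is_inj bij_is_surj inj_vimage_image_eq surj_image_vimage_eq)

lemma openin_homeo_ball:
  assumes g: "g \<in> Homeo"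
  shows "openin Homeo_top (homeo_ball k g)"
proof -
  let ?W = "range (prefix_of k)"
  let ?N = "\<lambda>w. {g'. g' ` {y. prefix_of k (g y) = w} = {z. prefix_of k z = w}}"
  have "openin Homeo_top (?N w \<inter> Homeo)" for w
  proof -
    have "locally_const ((\<lambda>v. v = w) \<circ> prefix_of k)"
      "locally_const ((\<lambda>v. v = w) \<circ> (prefix_of k \<circ> g))"
      by (intro locally_const_comp locally_const_comp_Homeo locally_const_prefix_of g)+
    then have "clopen_cantor {z. prefix_of k z = w}" "clopen_cantor {y. prefix_of k (g y) = w}"
      by (simp_all add: clopen_cantor_iff_locally_const comp_def)
    then show ?thesis
      unfolding Homeo_top_def by (intro openin_subtopology_Int topology_generated_by_Basis) blast
  qed
  then have "openin Homeo_top (Homeo \<inter> \<Inter> ((\<lambda>w. ?N w \<inter> Homeo) ` ?W))"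
    using openin_topspace[of Homeo_top]
    by (intro openin_Int_Inter) (auto simp: finite_range_prefix_of topspace_Homeo_top)
  moreover have "Homeo \<inter> \<Inter> ((\<lambda>w. ?N w \<inter> Homeo) ` ?W) = homeo_ball k g"
  proof (intro equalityI subsetI)
    fix g' assume g': "g' \<in> Homeo \<inter> \<Inter> ((\<lambda>w. ?N w \<inter> Homeo) ` ?W)"
    have "prefix_of k (g' y) = prefix_of k (g y)" for y
      using g' by (auto dest!: bspec[of _ _ "prefix_of k (g y)"])
    then show "g' \<in> homeo_ball k g"
      using g' by (auto simp: homeo_ball_def)
  next
    fix g' assume g': "g' \<in> homeo_ball k g"
    then have "prefix_of k (g' y) = prefix_of k (g y)" for y
      by (auto simp: homeo_ball_def dest: fun_cong[of _ _ y])
    then show "g' \<in> Homeo \<inter> \<Inter> ((\<lambda>w. ?N w \<inter> Homeo) ` ?W)"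
      using g' by (auto simp: homeo_ball_def bij_image_eq_iff bij_if_Homeo)
  qed
  ultimately show ?thesis
    by simp
qed

lemma eventually_homeo_ball_image:
  assumes g: "g \<in> Homeo" and C: "g ` C = D" and D: "clopen_cantor D"
  shows "\<forall>\<^sub>F k in sequentially. homeo_ball k g \<subseteq> {g'. g' ` C = D}"
proof (rule eventually_mono)
  show "\<forall>\<^sub>F k in sequentially. determines (prefix_of k) (\<lambda>z. z \<in> D)"
    using D by (simp add: clopen_cantor_iff_locally_const eventually_determines_prefix_of)
  fix k assume k: "determines (prefix_of k) (\<lambda>z. z \<in> D)"
  show "homeo_ball k g \<subseteq> {g'. g' ` C = D}"
  proof
    fix g' assume g': "g' \<in> homeo_ball k g"
    have "g' -` D = g -` D"
      using fun_cong[OF comp_eq_if_homeo_ball[OF g' k]] by auto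
    moreover have "C = g -` D"
      using C bij_if_Homeo[OF g] by (simp add: bij_image_eq_iff)
    moreover have "bij g'"
      using g' by (simp add: homeo_ball_def bij_if_Homeo)
    ultimately show "g' \<in> {g'. g' ` C = D}"
      by (simp add: bij_image_eq_iff)
  qed
qed

lemma eventually_homeo_ball_subset:
  assumes "openin Homeo_top U" "g \<in> U"
  shows "\<forall>\<^sub>F k in sequentially. homeo_ball k g \<subseteq> U"
proof -
  let ?S = "{{g. g ` C = D} | C D. clopen_cantor C \<and> clopen_cantor D}"
  obtain V where V: "generate_topology_on ?S V" "U = V \<inter> Homeo"
    using assms(1) unfolding Homeo_top_def openin_subtopology
    by (auto simp: openin_topology_generated_by_iff)
  have "g \<in> V" "g \<in> Homeo"
    using assms(2) V(2) by auto
  from V(1) \<open>g \<in> V\<close> have "\<forall>\<^sub>F k in sequentially. homeo_ball k g \<subseteq> V"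
  proof induction
    case (Int A B)
    then show ?case
      by (auto elim: eventually_elim2)
  next
    case (UN \<A>)
    then obtain A where "A \<in> \<A>" "\<forall>\<^sub>F k in sequentially. homeo_ball k g \<subseteq> A"
      by blast
    then show ?case
      by (auto elim!: eventually_mono)
  next
    case (Basis s)
    then obtain C D where s: "s = {g. g ` C = D}" and D: "clopen_cantor D"
      by blast
    then show ?case
      using eventually_homeo_ball_image[OF \<open>g \<in> Homeo\<close> _ D] Basis(2) by simp
  qed simp
  then show ?thesis
    unfolding V(2) by eventually_elim (auto simp: homeo_ball_def)
qed

definition fixing :: "cantor set \<Rightarrow> (cantor \<Rightarrow> cantor) set" where
  "fixing F = {g \<in> Homeo. \<forall>p\<in>F. g p = p}"

lemma fixing_Homeo: "g \<in> fixing F \<Longrightarrow> g \<in> Homeo"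
  by (simp add: fixing_def)

lemma topspace_fixing_top: "topspace (subtopology Homeo_top (fixing F)) = fixing F"
  by (auto simp: topspace_Homeo_top fixing_def)

lemma id_in_fixing: "id \<in> fixing F"
  by (simp add: fixing_def Homeo_id)

lemma fixing_conj:
  assumes "g \<in> fixing F" "h \<in> fixing F"
  shows "inv g \<circ> h \<circ> g \<in> fixing F"
proof -
  have "inv g p = p" if "p \<in> F" for p
    using assms(1) that bij_if_Homeo bij_is_inj by (auto simp: fixing_def intro: inv_f_eq)
  then show ?thesis
    using assms Homeo_comp Homeo_inv by (auto simp: fixing_def)
qed

section \<open>Lifting partitions and back-and-forth\<close>

lemma infinite_fibre:
  assumes "locally_const \<rho>"
  shows "infinite {w. \<rho> w = \<rho> y}"
proof -
  obtain k where k: "determines (prefix_of k) \<rho>"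
    using assms by (auto simp: locally_const_def)
  define w where "w i = y(k + i := \<not> y (k + i))" for i
  have "inj w"
    by (auto simp: inj_def w_def fun_eq_iff)
  moreover have "prefix_of k (w i) = prefix_of k y" for i
    by (simp add: w_def prefix_of_eq_iff)
  then have "range w \<subseteq> {w. \<rho> w = \<rho> y}"
    using determinesD[OF k] by blast
  ultimately show ?thesis
    using finite_imageD infinite_super by blast
qed

lemma inj_section_avoiding:
  assumes "locally_const \<rho>" "finite F" "finite V" "\<delta> ` V \<subseteq> range \<rho>"
  shows "\<exists>y. inj_on y V \<and> (\<forall>v\<in>V. \<rho> (y v) = \<delta> v \<and> y v \<notin> F)"
  using assms(3,4)
proof (induction V)
  case (insert a V)
  then obtain y where y: "inj_on y V" "\<forall>v\<in>V. \<rho> (y v) = \<delta> v \<and> y v \<notin> F"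
    by auto
  obtain w where "\<rho> w = \<delta> a"
    using insert by auto
  then have "infinite ({z. \<rho> z = \<delta> a} - (F \<union> y ` V))"
    using infinite_fibre[OF assms(1), of w] insert(1) assms(2) by auto
  then obtain z where "\<rho> z = \<delta> a" "z \<notin> F" "z \<notin> y ` V"
    using infinite_imp_nonempty by blast
  with y insert(2) show ?case
    by (intro exI[of _ "y(a := z)"]) (auto simp: inj_on_def image_iff)
qed auto

lemma eventually_inj_on_prefix_of:
  assumes "finite H"
  shows "\<forall>\<^sub>F k in sequentially. inj_on (prefix_of k) H"
  unfolding inj_on_def
proof (intro eventually_ball_finite ballI assms)
  fix y z
  show "\<forall>\<^sub>F k in sequentially. prefix_of k y = prefix_of k z \<longrightarrow> y = z"
  proof (cases "y = z")
    case False
    then obtain i where "y i \<noteq> z i"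
      by blast
    then have "prefix_of k y \<noteq> prefix_of k z" if "k > i" for k
      using that by (auto simp: prefix_of_eq_iff)
    then show ?thesis
      by (intro eventually_mono[OF eventually_gt_at_top[of i]]) blast
  qed simp
qed

lemma locally_const_interpolation:
  assumes "locally_const \<rho>" "finite H" and V: "range \<rho> \<subseteq> \<delta> ` V"
    and d: "\<And>z. z \<in> H \<Longrightarrow> d z \<in> V \<and> \<delta> (d z) = \<rho> z"
  obtains \<sigma> where "locally_const \<sigma>" "range \<sigma> \<subseteq> V" "\<delta> \<circ> \<sigma> = \<rho>" "\<And>z. z \<in> H \<Longrightarrow> \<sigma> z = d z"
proof -
  have "\<forall>\<^sub>F k in sequentially. determines (prefix_of k) \<rho> \<and> inj_on (prefix_of k) H"
    using assms
    by (intro eventually_conj eventually_determines_prefix_of eventually_inj_on_prefix_of)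
  then obtain k f where \<rho>: "\<rho> = f \<circ> prefix_of k" and inj: "inj_on (prefix_of k) H"
    by (auto simp: eventually_sequentially determines_iff_factor)
  define s where "s w = (if w \<in> prefix_of k ` H then d (inv_into H (prefix_of k) w)
    else inv_into V \<delta> (f w))" for w
  define \<sigma> where "\<sigma> = s \<circ> prefix_of k"
  have \<sigma>_H: "\<sigma> z = d z" if "z \<in> H" for z
    using that inj by (simp add: \<sigma>_def s_def)
  have \<sigma>: "\<sigma> y \<in> V \<and> \<delta> (\<sigma> y) = \<rho> y" for y
  proof (cases "prefix_of k y \<in> prefix_of k ` H")
    case True
    then obtain z where "z \<in> H" "prefix_of k y = prefix_of k z"
      by blast
    then show ?thesis
      using \<sigma>_H d[of z] by (simp add: \<sigma>_def \<rho>)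
  next
    case False
    then have "\<sigma> y = inv_into V \<delta> (\<rho> y)"
      by (simp add: \<sigma>_def s_def \<rho>)
    moreover have "\<rho> y \<in> \<delta> ` V"
      using V by blast
    ultimately show ?thesis
      by (simp add: inv_into_into f_inv_into_f)
  qed
  show ?thesis
  proof (rule that)
    show "locally_const \<sigma>"
      unfolding \<sigma>_def by (intro locally_const_comp locally_const_prefix_of)
  qed (use \<sigma> \<sigma>_H in \<open>auto simp: fun_eq_iff\<close>)
qed

lemma locally_const_lift:
  assumes \<rho>: "locally_const \<rho>" and F: "finite F" and V: "finite V" "\<delta> ` V = range \<rho>"
    and d: "\<And>p. p \<in> F \<Longrightarrow> d p \<in> V \<and> \<delta> (d p) = \<rho> p"
  obtains \<sigma> where "locally_const \<sigma>" "range \<sigma> = V" "\<delta> \<circ> \<sigma> = \<rho>" "\<And>p. p \<in> F \<Longrightarrow> \<sigma> p = d p"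
proof -
  obtain y where y: "inj_on y V" "\<forall>v\<in>V. \<rho> (y v) = \<delta> v \<and> y v \<notin> F"
    using inj_section_avoiding[OF \<rho> F V(1)] V(2) by blast
  define e where "e z = (if z \<in> F then d z else inv_into V y z)" for z
  have e_y: "e (y v) = v" if "v \<in> V" for v
    using that y by (simp add: e_def)
  have "e z \<in> V \<and> \<delta> (e z) = \<rho> z" if "z \<in> F \<union> y ` V" for z
    using that d y e_y by (auto simp: e_def)
  then obtain \<sigma> where \<sigma>: "locally_const \<sigma>" "range \<sigma> \<subseteq> V" "\<delta> \<circ> \<sigma> = \<rho>"
    "\<And>z. z \<in> F \<union> y ` V \<Longrightarrow> \<sigma> z = e z"
    using locally_const_interpolation[OF \<rho>, of "F \<union> y ` V" \<delta> V e] F V by auto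
  have "v \<in> range \<sigma>" if "v \<in> V" for v
    using \<sigma>(4)[of "y v"] e_y[OF that] that by (metis UnI2 imageI rangeI)
  then have "range \<sigma> = V"
    using \<sigma>(2) by blast
  moreover have "\<sigma> p = d p" if "p \<in> F" for p
    using that \<sigma>(4) by (simp add: e_def)
  ultimately show ?thesis
    using that \<sigma>(1,3) by blast
qed

definition compatible :: "cantor set \<Rightarrow> (cantor \<Rightarrow> 'a) \<Rightarrow> (cantor \<Rightarrow> 'a) \<Rightarrow> bool" where
  "compatible F u v \<longleftrightarrow> locally_const u \<and> locally_const v \<and> range u = range v \<and> (\<forall>p\<in>F. u p = v p)"

lemma compatible_sym: "compatible F u v \<Longrightarrow> compatible F v u"
  by (auto simp: compatible_def)

lemma compatible_comp: "compatible F u v \<Longrightarrow> compatible F (f \<circ> u) (f \<circ> v)"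
  by (simp add: compatible_def locally_const_comp) (metis image_image)

lemma compatible_lift:
  assumes F: "finite F" and uv: "compatible F (\<phi> \<circ> u) v" and u: "locally_const u"
  obtains v' where "compatible F u v'" "\<phi> \<circ> v' = v"
proof -
  have v: "locally_const v" "range v = \<phi> ` range u" "\<And>p. p \<in> F \<Longrightarrow> \<phi> (u p) = v p"
    using uv by (auto simp: compatible_def image_comp)
  obtain v' where v': "locally_const v'" "range v' = range u" "\<phi> \<circ> v' = v" "\<And>p. p \<in> F \<Longrightarrow> v' p = u p"
    using locally_const_lift[OF v(1) F finite_range_locally_const[OF u], of \<phi> u] v(2,3) by auto
  then have "compatible F u v'"
    using u by (simp add: compatible_def)
  then show ?thesis
    using v'(3) by (rule that)
qed

lemma limit_map:
  fixes U W :: "nat \<Rightarrow> cantor \<Rightarrow> 'a"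
  assumes W: "\<And>k. locally_const (W k)" "\<And>k. determines (W k) (prefix_of k)"
    and range: "\<And>k. range (U k) \<subseteq> range (W k)"
    and \<phi>: "\<And>k. \<phi> \<circ> U (Suc k) = U k" "\<And>k. \<phi> \<circ> W (Suc k) = W k"
  obtains g where "\<And>k. W k \<circ> g = U k"
proof -
  have down: "W k z = U k y" if "W l z = U l y" "k \<le> l" for k l y z
    using that(2,1) by (induction rule: dec_induct) (metis \<phi> comp_apply)+
  have "\<exists>z. W k z = U k y" for k y
    using range[of k] by (metis imageE rangeI subsetD)
  then obtain z where z: "\<And>k y. W k (z k y) = U k y"
    by metis
  define g where "g y i = z (Suc i) y i" for y i
  have prefix_g: "prefix_of k (g y) = prefix_of k (z k y)" for k y
    unfolding prefix_of_eq_iff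
  proof (intro allI impI)
    fix i assume "i < k"
    then have "W (Suc i) (z k y) = W (Suc i) (z (Suc i) y)"
      using down[OF z, of "Suc i" k y] z by simp
    then have "prefix_of (Suc i) (z k y) = prefix_of (Suc i) (z (Suc i) y)"
      by (rule determinesD[OF W(2)])
    then show "g y i = z k y i"
      by (simp add: prefix_of_eq_iff g_def)
  qed
  have "W k (g y) = U k y" for k y
  proof -
    obtain l where l: "k \<le> l" "determines (prefix_of l) (W k)"
      using eventually_conj[OF eventually_ge_at_top[of k]
          eventually_determines_prefix_of[OF W(1)[of k]]]
      by (auto simp: eventually_sequentially)
    have "W k (g y) = W k (z l y)"
      using prefix_g by (rule determinesD[OF l(2)])
    then show ?thesis
      using down[OF z l(1)] by simp
  qed
  then show ?thesis
    using that by (metis comp_def ext)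
qed

lemma limit_homeomorphism:
  fixes U W :: "nat \<Rightarrow> cantor \<Rightarrow> 'a"
  assumes UW: "\<And>k. compatible F (U k) (W k)"
    and det: "\<And>k. determines (U k) (prefix_of k)" "\<And>k. determines (W k) (prefix_of k)"
    and \<phi>: "\<And>k. \<phi> \<circ> U (Suc k) = U k" "\<And>k. \<phi> \<circ> W (Suc k) = W k"
  obtains g where "g \<in> fixing F" "\<And>k. W k \<circ> g = U k"
proof -
  have U: "locally_const (U k)" and W: "locally_const (W k)" and range: "range (U k) = range (W k)"
    and marks: "\<And>p. p \<in> F \<Longrightarrow> U k p = W k p" for k
    using UW[of k] by (auto simp: compatible_def)
  obtain g where g: "\<And>k. W k \<circ> g = U k"
    using limit_map[of W U \<phi>] W det(2) range \<phi> by auto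
  obtain f where f: "\<And>k. U k \<circ> f = W k"
    using limit_map[of U W \<phi>] U det(1) range \<phi> by auto
  have g_apply: "W k (g y) = U k y" and f_apply: "U k (f y) = W k y" for k y
    using fun_cong[OF g] fun_cong[OF f] by simp_all
  have separates: "y = z" if "\<And>k. V k y = V k z" "\<And>k. determines (V k) (prefix_of k)"
    for V :: "nat \<Rightarrow> cantor \<Rightarrow> 'a" and y z
    using that determinesD eq_if_prefixes_eq by metis
  have "g \<in> Homeo"
  proof (rule HomeoI)
    show "g \<circ> f = id"
      by (intro ext separates[of W]) (simp_all add: det g_apply f_apply)
    show "f \<circ> g = id"
      by (intro ext separates[of U]) (simp_all add: det g_apply f_apply)
    have continuous: "locally_const (prefix_of k \<circ> e)"
      if "\<And>k. V k \<circ> e = V' k" "\<And>k. determines (V k) (prefix_of k)" "\<And>k. locally_const (V' k)"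
      for V V' :: "nat \<Rightarrow> cantor \<Rightarrow> 'a" and e k
      using that locally_const_comp by (metis comp_assoc determines_iff_factor)
    show "locally_const (prefix_of k \<circ> g)" for k
      by (rule continuous[OF g det(2) U])
    show "locally_const (prefix_of k \<circ> f)" for k
      by (rule continuous[OF f det(1) W])
  qed
  moreover have "g p = p" if "p \<in> F" for p
    by (rule separates[of W]) (simp_all add: det g_apply marks that)
  ultimately have "g \<in> fixing F"
    by (simp add: fixing_def)
  then show ?thesis
    using g by (rule that)
qed

lemma forth_then_back:
  assumes go_forth: "\<And>u v k. P u v \<Longrightarrow>
      \<exists>u' v'. P u' v' \<and> \<phi> \<circ> u' = u \<and> \<phi> \<circ> v' = v \<and> determines u' (prefix_of k)"
    and go_back: "\<And>u v k. P u v \<Longrightarrow>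
      \<exists>u' v'. P u' v' \<and> \<phi> \<circ> u' = u \<and> \<phi> \<circ> v' = v \<and> determines v' (prefix_of k)"
    and P: "P u v"
  obtains u' v' where "P u' v'" "\<phi> \<circ> \<phi> \<circ> u' = u" "\<phi> \<circ> \<phi> \<circ> v' = v"
    "determines u' (prefix_of k)" "determines v' (prefix_of k)"
proof -
  obtain u1 v1 where forth: "P u1 v1" "\<phi> \<circ> u1 = u" "\<phi> \<circ> v1 = v" "determines u1 (prefix_of k)"
    using go_forth[OF P] by blast
  obtain u2 v2 where both: "P u2 v2" "\<phi> \<circ> u2 = u1" "\<phi> \<circ> v2 = v1" "determines v2 (prefix_of k)"
    using go_back[OF forth(1)] by blast
  have "determines u2 u1"
    using both(2)[symmetric] by (rule determinesI)
  then have "determines u2 (prefix_of k)"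
    using forth(4) by (rule determines_trans)
  then show ?thesis
    using forth both by (intro that[of u2 v2]) (simp_all add: comp_assoc)
qed

lemma back_and_forth:
  fixes P :: "(cantor \<Rightarrow> 'a) \<Rightarrow> (cantor \<Rightarrow> 'a) \<Rightarrow> bool"
  assumes start: "P u v" and compatible: "\<And>u v. P u v \<Longrightarrow> compatible F u v"
    and go_forth: "\<And>u v k. P u v \<Longrightarrow>
      \<exists>u' v'. P u' v' \<and> \<phi> \<circ> u' = u \<and> \<phi> \<circ> v' = v \<and> determines u' (prefix_of k)"
    and go_back: "\<And>u v k. P u v \<Longrightarrow>
      \<exists>u' v'. P u' v' \<and> \<phi> \<circ> u' = u \<and> \<phi> \<circ> v' = v \<and> determines v' (prefix_of k)"
  obtains g where "g \<in> fixing F" "v \<circ> g = u"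
    "\<forall>k. \<exists>u' v'. P u' v' \<and> determines u' (prefix_of k) \<and> v' \<circ> g = u'"
proof -
  define Q where "Q k = (\<lambda>(u, v).
    P u v \<and> determines u (prefix_of k) \<and> determines v (prefix_of k))" for k
  define R where "R = (\<lambda>(u, v) (u', v').
    \<phi> \<circ> \<phi> \<circ> u' = (u :: cantor \<Rightarrow> 'a) \<and> \<phi> \<circ> \<phi> \<circ> v' = (v :: cantor \<Rightarrow> 'a))"
  have step: "\<exists>s'. Q k s' \<and> R s s'" if Ps: "P (fst s) (snd s)" for s k
  proof -
    obtain u' v' where "P u' v'" "\<phi> \<circ> \<phi> \<circ> u' = fst s" "\<phi> \<circ> \<phi> \<circ> v' = snd s"
      "determines u' (prefix_of k)" "determines v' (prefix_of k)"
      by (rule forth_then_back[of P \<phi>, OF go_forth go_back Ps])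
    then show ?thesis
      by (intro exI[of _ "(u', v')"]) (simp add: Q_def R_def split: prod.splits)
  qed
  obtain s0 where s0: "Q 0 s0" "R (u, v) s0"
    using step[of "(u, v)" 0] start by auto
  have "\<exists>S. \<forall>k. (Q k (S k) \<and> (k = 0 \<longrightarrow> S k = s0)) \<and> R (S k) (S (Suc k))"
    by (rule dependent_nat_choice) (use s0(1) step in \<open>auto simp: Q_def split: prod.splits\<close>)
  then obtain S where Q: "\<And>k. Q k (S k)" and S0: "S 0 = s0" and R: "\<And>k. R (S k) (S (Suc k))"
    by blast
  define U where "U k = fst (S k)" for k
  define W where "W k = snd (S k)" for k
  have P: "P (U k) (W k)"
    and det: "determines (U k) (prefix_of k)" "determines (W k) (prefix_of k)" for k
    using Q[of k] by (auto simp: Q_def U_def W_def split: prod.splits)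
  have "\<phi> \<circ> \<phi> \<circ> U (Suc k) = U k" "\<phi> \<circ> \<phi> \<circ> W (Suc k) = W k" for k
    using R[of k] by (auto simp: R_def U_def W_def split: prod.splits)
  then obtain g where g: "g \<in> fixing F" "\<And>k. W k \<circ> g = U k"
    using limit_homeomorphism[OF compatible[OF P] det] by blast
  have "\<phi> \<circ> \<phi> \<circ> U 0 = u" "\<phi> \<circ> \<phi> \<circ> W 0 = v"
    using s0(2) S0 by (auto simp: R_def U_def W_def split: prod.splits)
  then have "v \<circ> g = u"
    using g(2)[of 0] by (metis comp_assoc)
  then show ?thesis
    using that g P det(1) by blast
qed

lemma fixing_homogeneous:
  fixes u v :: "cantor \<Rightarrow> 'a"
  assumes F: "finite F" and uv: "compatible F u v"
  obtains g where "g \<in> fixing F" "v \<circ> g = u"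
proof -
  \<comment> \<open>The labels carry a stack of prefixes, so that \<open>apsnd tl\<close> undoes a refinement.\<close>
  define \<phi> :: "'a \<times> bool list list \<Rightarrow> 'a \<times> bool list list" where "\<phi> = apsnd tl"
  have go_forth: "\<exists>a' b'. compatible F a' b' \<and> \<phi> \<circ> a' = a \<and> \<phi> \<circ> b' = b \<and>
      determines a' (prefix_of k)"
    if ab: "compatible F a b" for a b :: "cantor \<Rightarrow> 'a \<times> bool list list" and k
  proof -
    define a' where "a' = (\<lambda>(w, c, ws). (c, w # ws)) \<circ> (\<lambda>y. (prefix_of k y, a y))"
    have "locally_const a'"
      unfolding a'_def using ab
      by (intro locally_const_comp locally_const_pair locally_const_prefix_of)
        (simp add: compatible_def)
    moreover have "\<phi> \<circ> a' = a"
      by (auto simp: a'_def \<phi>_def split: prod.splits)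
    moreover have "determines a' (prefix_of k)"
      by (auto simp: determines_def a'_def split: prod.splits)
    moreover obtain b' where "compatible F a' b'" "\<phi> \<circ> b' = b"
      using compatible_lift[OF F _ \<open>locally_const a'\<close>, of \<phi> b] \<open>\<phi> \<circ> a' = a\<close> ab by metis
    ultimately show ?thesis
      by blast
  qed
  then have go_back: "\<exists>a' b'. compatible F a' b' \<and> \<phi> \<circ> a' = a \<and> \<phi> \<circ> b' = b \<and>
      determines b' (prefix_of k)"
    if "compatible F a b" for a b :: "cantor \<Rightarrow> 'a \<times> bool list list" and k
    using compatible_sym that by metis
  define start :: "'a \<Rightarrow> 'a \<times> bool list list" where "start = (\<lambda>c. (c, []))"
  obtain g where g: "g \<in> fixing F" "(start \<circ> v) \<circ> g = start \<circ> u"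
    by (rule back_and_forth[where P = "compatible F",
          OF compatible_comp[OF uv] _ go_forth go_back]) blast
  from g(2) have "v \<circ> g = u"
    by (auto simp: fun_eq_iff start_def)
  with g(1) show ?thesis
    by (rule that)
qed

section \<open>Graphs of partitions\<close>

text \<open>A tuple of \<open>m\<close> homeomorphisms induces on the set of cells of a finite partition the
  \<open>m\<close> relations ``some point of \<open>a\<close> is mapped into \<open>b\<close>''. Directions \<open>(i, True)\<close> and
  \<open>(i, False)\<close> stand for following the \<open>i\<close>-th relation forwards and backwards.\<close>
type_synonym 'v edges = "(nat \<times> 'v \<times> 'v) set"

definition dirs :: "nat \<Rightarrow> (nat \<times> bool) set" where
  "dirs m = {..<m} \<times> UNIV"

definition opp :: "nat \<times> bool \<Rightarrow> nat \<times> bool" where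
  "opp s = (fst s, \<not> snd s)"

definition adj :: "'v edges \<Rightarrow> nat \<times> bool \<Rightarrow> 'v \<Rightarrow> 'v \<Rightarrow> bool" where
  "adj E s a b \<longleftrightarrow> (if snd s then (fst s, a, b) \<in> E else (fst s, b, a) \<in> E)"

definition total_graph :: "nat \<Rightarrow> 'v set \<Rightarrow> 'v edges \<Rightarrow> bool" where
  "total_graph m V E \<longleftrightarrow> finite V \<and> E \<subseteq> {..<m} \<times> V \<times> V \<and> (\<forall>a\<in>V. \<forall>s\<in>dirs m. \<exists>b. adj E s a b)"

definition has_loops :: "nat \<Rightarrow> 'v edges \<Rightarrow> 'v \<Rightarrow> bool" where
  "has_loops m E a \<longleftrightarrow> (\<forall>i<m. (i, a, a) \<in> E)"

definition edge_map :: "('v \<Rightarrow> 'w) \<Rightarrow> 'v edges \<Rightarrow> 'w edges" where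
  "edge_map f E = (\<lambda>(i, a, b). (i, f a, f b)) ` E"

lemma finite_dirs: "finite (dirs m)"
  by (simp add: dirs_def)

lemma opp_opp [simp]: "opp (opp s) = s"
  by (simp add: opp_def)

lemma opp_in_dirs [simp]: "opp s \<in> dirs m \<longleftrightarrow> s \<in> dirs m"
  by (cases s) (simp add: opp_def dirs_def)

lemma adj_opp [simp]: "adj E (opp s) a b \<longleftrightarrow> adj E s b a"
  by (auto simp: adj_def opp_def)

lemma adj_in_edge_map:
  assumes "adj E s a b" "edge_map f E \<subseteq> E'"
  shows "adj E' s (f a) (f b)"
  using assms by (force simp: adj_def edge_map_def split: if_splits)

lemma total_graph_adjD:
  assumes "total_graph m V E" "adj E s a b"
  shows "a \<in> V" "b \<in> V" "s \<in> dirs m"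
  using assms unfolding total_graph_def adj_def dirs_def by (cases s; auto split: if_splits)+

lemma total_graph_adjE:
  assumes "total_graph m V E" "a \<in> V" "s \<in> dirs m"
  obtains b where "adj E s a b" "b \<in> V"
  using assms total_graph_adjD unfolding total_graph_def by metis

lemma total_graph_relation:
  assumes "total_graph m V E" "i < m"
  shows "fst ` {(a, b). (i, a, b) \<in> E} = V" "snd ` {(a, b). (i, a, b) \<in> E} = V"
proof -
  have "\<exists>b. adj E (i, True) a b" "\<exists>b. adj E (i, False) a b" if "a \<in> V" for a
    using assms that unfolding total_graph_def dirs_def by blast+
  then have "V \<subseteq> fst ` {(a, b). (i, a, b) \<in> E}" "V \<subseteq> snd ` {(a, b). (i, a, b) \<in> E}"
    by (force simp: adj_def)+
  then show "fst ` {(a, b). (i, a, b) \<in> E} = V" "snd ` {(a, b). (i, a, b) \<in> E} = V"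
    using assms(1) by (auto simp: total_graph_def)
qed

text \<open>\<open>T a\<close> is a set of directions in which the neighbour of \<open>a\<close> is unique. At most one direction
  is exempt, namely the one leading back to where \<open>a\<close> was entered from; so a labelling of
  the tree of the free group by \<open>E\<close> is determined away from any vertex by the label there.\<close>
locale branch_system =
  fixes m :: nat and M :: "'v set" and E :: "'v edges" and T :: "'v \<Rightarrow> (nat \<times> bool) set"
  assumes unique_neighbour: "s \<in> T a \<Longrightarrow> adj E s a b \<Longrightarrow> adj E s a b' \<Longrightarrow> b = b'"
    and exempt_backwards: "s \<in> T a \<Longrightarrow> adj E s a b \<Longrightarrow> dirs m - T b \<subseteq> {opp s}"
    and exempt_at_one_end: "adj E s a b \<Longrightarrow> s \<in> T a \<or> opp s \<in> T b"
    and exempt_unique: "s \<in> dirs m - T a \<Longrightarrow> t \<in> dirs m - T a \<Longrightarrow> s = t"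
    and none_exempt_at_mark: "a \<in> M \<Longrightarrow> dirs m \<subseteq> T a"

definition branching :: "nat \<Rightarrow> 'v set \<Rightarrow> 'v edges \<Rightarrow> bool" where
  "branching m M E \<longleftrightarrow> (\<exists>T. branch_system m M E T)"

lemma branching_if_inj_image:
  assumes "branching m (f ` M) (edge_map f E)" "inj_on f V" "E \<subseteq> {..<m} \<times> V \<times> V"
  shows "branching m M E"
proof -
  obtain T where T: "branch_system m (f ` M) (edge_map f E) T"
    using assms(1) by (auto simp: branching_def)
  interpret branch_system m "f ` M" "edge_map f E" T by (rule T)
  have adj_f: "adj (edge_map f E) s (f a) (f b)" if "adj E s a b" for s a b
    using that by (rule adj_in_edge_map) simp
  have "branch_system m M E (T \<circ> f)"
  proof
    show "b = b'" if "s \<in> (T \<circ> f) a" "adj E s a b" "adj E s a b'" for s a b b'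
    proof (rule inj_onD[OF assms(2)])
      show "f b = f b'"
        using that adj_f unique_neighbour by (metis comp_apply)
    qed (use that(2,3) assms(3) in \<open>auto simp: adj_def split: if_splits\<close>)
  next
    show "dirs m - (T \<circ> f) b \<subseteq> {opp s}" if "s \<in> (T \<circ> f) a" "adj E s a b" for s a b
      using exempt_backwards[OF _ adj_f[OF that(2)]] that(1) by simp
    show "s \<in> (T \<circ> f) a \<or> opp s \<in> (T \<circ> f) b" if "adj E s a b" for s a b
      using exempt_at_one_end[OF adj_f[OF that]] by simp
    show "s = t" if "s \<in> dirs m - (T \<circ> f) a" "t \<in> dirs m - (T \<circ> f) a" for s t a
      using exempt_unique that by simp
    show "dirs m \<subseteq> (T \<circ> f) a" if "a \<in> M" for a
      using none_exempt_at_mark that by simp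
  qed
  then show ?thesis
    by (auto simp: branching_def)
qed

section \<open>Amalgamation over branching graphs\<close>

locale branching_cospan = branch_system m M A T
  for m :: nat and M :: "'a set" and A :: "'a edges" and T +
  fixes VB :: "'b set" and B :: "'b edges" and \<phi> :: "'b \<Rightarrow> 'a"
    and VC :: "'c set" and C :: "'c edges" and \<psi> :: "'c \<Rightarrow> 'a"
  assumes total_B: "total_graph m VB B" and total_C: "total_graph m VC C"
    and hom_B: "edge_map \<phi> B \<subseteq> A" and hom_C: "edge_map \<psi> C \<subseteq> A"
    and same_image: "\<phi> ` VB = \<psi> ` VC"
begin

lemma swapped: "branching_cospan m M A T VC C \<psi> VB B \<phi>"
  using total_B total_C hom_B hom_C same_image by unfold_locales auto

text \<open>In the directions \<open>T (\<phi> b)\<close> the neighbours of \<open>b\<close> and \<open>c\<close> automatically lie over the same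
  vertex, so only the exempt direction can obstruct totality of the fibre product.\<close>
definition prune :: "('b \<times> 'c) set \<Rightarrow> ('b \<times> 'c) set" where
  "prune X = {(b, c). b \<in> VB \<and> c \<in> VC \<and> \<phi> b = \<psi> c \<and>
    (\<forall>s\<in>dirs m - T (\<phi> b). \<exists>b' c'. (b', c') \<in> X \<and> adj B s b b' \<and> adj C s c c')}"

definition core :: "('b \<times> 'c) set" where
  "core = gfp prune"

definition core_edges :: "('b \<times> 'c) edges" where
  "core_edges = {(i, v, w). v \<in> core \<and> w \<in> core \<and> (i, fst v, fst w) \<in> B \<and> (i, snd v, snd w) \<in> C}"

lemma mono_prune: "mono prune"
  unfolding prune_def by (intro monoI) blast

lemma core_unfold: "core = prune core"
  unfolding core_def by (rule gfp_unfold[OF mono_prune])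

lemma core_greatest: "X \<subseteq> prune X \<Longrightarrow> X \<subseteq> core"
  unfolding core_def by (rule gfp_upperbound)

lemma prune_subset: "prune X \<subseteq> VB \<times> VC"
  by (auto simp: prune_def)

lemma coreD:
  assumes "(b, c) \<in> core"
  shows "b \<in> VB" "c \<in> VC" "\<phi> b = \<psi> c"
  using assms core_unfold by (auto simp: prune_def)

lemma finite_VB_VC: "finite (VB \<times> VC)"
  using total_B total_C by (simp add: total_graph_def)

lemma core_eq_iterate: "\<exists>k. core = (prune ^^ k) UNIV"
proof -
  define R where "R k = (prune ^^ Suc k) UNIV" for k
  have "R (Suc k) \<subseteq> R k" for k
    unfolding R_def by (induction k) (simp_all add: monoD[OF mono_prune])
  moreover obtain k where "\<And>l. card (R k) \<le> card (R l)"
    using ex_has_least_nat[of "\<lambda>_. True" 0 "\<lambda>k. card (R k)"] by auto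
  moreover have "finite (R k)"
    using finite_subset[OF prune_subset finite_VB_VC] by (simp add: R_def)
  ultimately have "R (Suc k) = R k"
    by (intro card_seteq)
  then have "core = R k"
    unfolding core_def R_def by (intro gfp_Kleene_iter mono_prune)
  then show ?thesis
    unfolding R_def by blast
qed

text \<open>Follow the exempt directions from \<open>b\<close> in \<open>B\<close>, choose a partner for the last vertex and walk
  back in \<open>C\<close>: on the way back the neighbour in \<open>A\<close> is unique.\<close>
lemma vertex_in_iterate: "b \<in> VB \<Longrightarrow> \<exists>c\<in>VC. \<phi> b = \<psi> c \<and> (b, c) \<in> (prune ^^ k) UNIV"
proof (induction k arbitrary: b)
  case 0
  then show ?case
    using same_image by auto
next
  case (Suc k)
  show ?case
  proof (cases "dirs m \<subseteq> T (\<phi> b)")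
    case True
    moreover obtain c where "c \<in> VC" "\<phi> b = \<psi> c"
      using Suc.prems same_image by blast
    ultimately show ?thesis
      using Suc.prems by (auto simp: prune_def)
  next
    case False
    then obtain s where s: "s \<in> dirs m" "s \<notin> T (\<phi> b)"
      by blast
    obtain b' where b': "adj B s b b'" "b' \<in> VB"
      using total_graph_adjE[OF total_B Suc.prems s(1)] by blast
    obtain c' where c': "c' \<in> VC" "\<phi> b' = \<psi> c'" "(b', c') \<in> (prune ^^ k) UNIV"
      using Suc.IH[OF b'(2)] by blast
    obtain c where c: "adj C (opp s) c' c" "c \<in> VC"
      using total_graph_adjE[OF total_C c'(1), of "opp s"] s(1) by auto
    have "opp s \<in> T (\<phi> b')"
      using exempt_at_one_end[OF adj_in_edge_map[OF b'(1) hom_B]] s(2) by blast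
    moreover have "adj A (opp s) (\<phi> b') (\<phi> b)"
      using adj_in_edge_map[OF b'(1) hom_B] by simp
    moreover have "adj A (opp s) (\<phi> b') (\<psi> c)"
      using adj_in_edge_map[OF c(1) hom_C] c'(2) by simp
    ultimately have "\<phi> b = \<psi> c"
      by (rule unique_neighbour)
    moreover have "t = s" if "t \<in> dirs m - T (\<phi> b)" for t
      using exempt_unique that s by blast
    ultimately have "(b, c) \<in> prune ((prune ^^ k) UNIV)"
      using Suc.prems b'(1) c c'(3) by (auto simp: prune_def)
    then show ?thesis
      using c(2) \<open>\<phi> b = \<psi> c\<close> by auto
  qed
qed

lemma fst_core: "fst ` core = VB"
proof
  show "VB \<subseteq> fst ` core"
    using core_eq_iterate vertex_in_iterate by (metis fst_conv image_eqI subsetI)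
qed (use coreD in auto)

lemma snd_core: "snd ` core = VC"
proof
  interpret swapped: branching_cospan m M A T VC C \<psi> VB B \<phi>
    by (rule swapped)
  have "swapped.core\<inverse> \<subseteq> prune (swapped.core\<inverse>)"
  proof (rule subrelI)
    fix b c assume "(b, c) \<in> swapped.core\<inverse>"
    then have "(c, b) \<in> swapped.prune swapped.core"
      using swapped.core_unfold by simp
    then show "(b, c) \<in> prune (swapped.core\<inverse>)"
      unfolding swapped.prune_def prune_def by simp metis
  qed
  then have "swapped.core\<inverse> \<subseteq> core"
    by (rule core_greatest)
  then show "VC \<subseteq> snd ` core"
    using swapped.fst_core by force
qed (use coreD in auto)

lemma core_mark:
  assumes "b \<in> VB" "c \<in> VC" "\<phi> b = \<psi> c" "\<phi> b \<in> M"
  shows "(b, c) \<in> core"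
proof -
  have "(b, c) \<in> prune core"
    using assms none_exempt_at_mark[OF assms(4)] by (auto simp: prune_def)
  then show ?thesis
    using core_unfold by simp
qed

lemma has_loops_core:
  "(b, c) \<in> core \<Longrightarrow> has_loops m B b \<Longrightarrow> has_loops m C c \<Longrightarrow> has_loops m core_edges (b, c)"
  by (simp add: has_loops_def core_edges_def)

lemma core_neighbour:
  assumes bc: "(b, c) \<in> core" and s: "s \<in> T (\<phi> b)" and adj: "adj B s b b'" "adj C s c c'"
  shows "(b', c') \<in> core"
proof -
  have adj_A: "adj A s (\<phi> b) (\<phi> b')" "adj A s (\<phi> b) (\<psi> c')"
    using adj_in_edge_map[OF adj(1) hom_B] adj_in_edge_map[OF adj(2) hom_C] coreD(3)[OF bc]
    by simp_all
  have "b' \<in> VB" "c' \<in> VC"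
    using total_graph_adjD(2)[OF total_B adj(1)] total_graph_adjD(2)[OF total_C adj(2)] .
  moreover have "\<phi> b' = \<psi> c'"
    using s adj_A by (rule unique_neighbour)
  moreover have "dirs m - T (\<phi> b') \<subseteq> {opp s}"
    using s adj_A(1) by (rule exempt_backwards)
  moreover have "adj B (opp s) b' b" "adj C (opp s) c' c"
    using adj by simp_all
  ultimately have "(b', c') \<in> prune core"
    unfolding prune_def using bc by blast
  then show ?thesis
    using core_unfold by simp
qed

lemma adj_core_edges:
  "adj core_edges s (b, c) (b', c') \<longleftrightarrow>
    (b, c) \<in> core \<and> (b', c') \<in> core \<and> adj B s b b' \<and> adj C s c c'"
  by (auto simp: adj_def core_edges_def)

lemma total_core: "total_graph m core core_edges"
  unfolding total_graph_def
proof (intro conjI ballI)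
  show "finite core"
    using finite_subset[OF prune_subset finite_VB_VC] core_unfold by metis
  show "core_edges \<subseteq> {..<m} \<times> core \<times> core"
    using total_B by (auto simp: core_edges_def total_graph_def)
  fix v s assume "v \<in> core" "s \<in> dirs m"
  then obtain b c where v: "v = (b, c)" "(b, c) \<in> core"
    by (cases v) auto
  have "\<exists>b' c'. (b', c') \<in> core \<and> adj B s b b' \<and> adj C s c c'"
  proof (cases "s \<in> T (\<phi> b)")
    case True
    obtain b' c' where "adj B s b b'" "adj C s c c'"
      using total_graph_adjE[OF total_B] total_graph_adjE[OF total_C] coreD[OF v(2)] \<open>s \<in> dirs m\<close>
      by metis
    then show ?thesis
      using core_neighbour[OF v(2) True] by blast
  next
    case False
    then show ?thesis
      using v(2) \<open>s \<in> dirs m\<close> core_unfold unfolding prune_def by blast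
  qed
  then show "\<exists>w. adj core_edges s v w"
    using v adj_core_edges by blast
qed

lemma edge_map_fst_core: "edge_map fst core_edges = B"
proof
  have lift: "\<exists>c c'. adj core_edges s (b, c) (b', c')"
    if adj: "adj B s b b'" and s: "s \<in> T (\<phi> b)" for s b b'
  proof -
    obtain c where c: "(b, c) \<in> core"
      using fst_core total_graph_adjD(1)[OF total_B adj] by force
    obtain c' where "adj C s c c'"
      using total_graph_adjE[OF total_C coreD(2)[OF c] total_graph_adjD(3)[OF total_B adj]] by blast
    then show ?thesis
      using core_neighbour[OF c s adj] c adj adj_core_edges by blast
  qed
  show "B \<subseteq> edge_map fst core_edges"
  proof
    fix e assume "e \<in> B"
    then obtain i b b' where e: "e = (i, b, b')" "adj B (i, True) b b'"
      by (cases e) (auto simp: adj_def)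
    have "\<exists>c c'. adj core_edges (i, True) (b, c) (b', c')"
      using exempt_at_one_end[OF adj_in_edge_map[OF e(2) hom_B]]
    proof
      assume "opp (i, True) \<in> T (\<phi> b')"
      then show ?thesis
        using lift[of "opp (i, True)" b' b] e(2) by auto
    qed (rule lift[OF e(2)])
    then show "e \<in> edge_map fst core_edges"
      unfolding e(1) edge_map_def by (force simp: adj_def)
  qed
qed (auto simp: edge_map_def core_edges_def)

lemma edge_map_snd_core: "edge_map snd core_edges \<subseteq> C"
  by (auto simp: edge_map_def core_edges_def)

end

section \<open>Branching covers\<close>

text \<open>The label of a neighbour of a \<open>Cone a t\<close> is chosen once and for all, except in the direction
  \<open>t\<close> (if any) towards the apex. \<open>Root a s b\<close> sits over \<open>a\<close> and uses the given edge to \<open>b\<close> in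
  direction \<open>s\<close>; these provide the missing neighbours of the cones.\<close>
datatype ('v, 'p) cover = Root 'v "nat \<times> bool" 'v | Cone 'v "(nat \<times> bool) option" | Mark 'p

locale marked_graph =
  fixes m :: nat and V :: "'v set" and E :: "'v edges" and F :: "'p set" and mark :: "'p \<Rightarrow> 'v"
    and nb :: "'v \<Rightarrow> nat \<times> bool \<Rightarrow> 'v"
  assumes total: "total_graph m V E" and finite_F: "finite F"
    and mark: "x \<in> F \<Longrightarrow> mark x \<in> V \<and> has_loops m E (mark x)"
    and nb: "a \<in> V \<Longrightarrow> s \<in> dirs m \<Longrightarrow> adj E s a (nb a s)"
begin

primrec base :: "('v, 'p) cover \<Rightarrow> 'v" where
  "base (Root a s b) = a"
| "base (Cone a t) = a"
| "base (Mark x) = mark x"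

primrec determined :: "('v, 'p) cover \<Rightarrow> (nat \<times> bool) set" where
  "determined (Root a s b) = dirs m"
| "determined (Cone a t) = dirs m - set_option t"
| "determined (Mark x) = dirs m"

primrec move :: "nat \<times> bool \<Rightarrow> ('v, 'p) cover \<Rightarrow> ('v, 'p) cover" where
  "move s (Root a t b) = Cone (if s = t then b else nb a s) (Some (opp s))"
| "move s (Cone a t) = Cone (nb a s) (Some (opp s))"
| "move s (Mark x) = Mark x"

definition vertices :: "('v, 'p) cover set" where
  "vertices = {Root a s b | a s b. adj E s a b} \<union>
    {Cone a t | a t. a \<in> V \<and> set_option t \<subseteq> dirs m} \<union> Mark ` F"

definition edges :: "('v, 'p) cover edges" where
  "edges = {(i, v, w). i < m \<and> v \<in> vertices \<and> w \<in> vertices \<and>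
    ((i, True) \<in> determined v \<and> w = move (i, True) v \<or>
     (i, False) \<in> determined w \<and> v = move (i, False) w)}"

lemma Root_in_vertices [simp]: "Root a s b \<in> vertices \<longleftrightarrow> adj E s a b"
  by (auto simp: vertices_def simp del: split_paired_Ex)

lemma Cone_in_vertices [simp]: "Cone a t \<in> vertices \<longleftrightarrow> a \<in> V \<and> set_option t \<subseteq> dirs m"
  by (auto simp: vertices_def)

lemma Mark_in_vertices [simp]: "Mark x \<in> vertices \<longleftrightarrow> x \<in> F"
  by (auto simp: vertices_def)

lemma adj_edges:
  "adj edges s v w \<longleftrightarrow> s \<in> dirs m \<and> v \<in> vertices \<and> w \<in> vertices \<and>
    (s \<in> determined v \<and> w = move s v \<or> opp s \<in> determined w \<and> v = move (opp s) w)"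
  by (cases s; cases "snd s") (auto simp: adj_def edges_def dirs_def opp_def)

lemma base_in_V: "v \<in> vertices \<Longrightarrow> base v \<in> V"
  using total_graph_adjD(1)[OF total] mark by (cases v) auto

lemma move_in_vertices:
  assumes "v \<in> vertices" "s \<in> dirs m"
  shows "move s v \<in> vertices"
proof -
  have "nb a s \<in> V" if "a \<in> V" for a
    using total_graph_adjD(2)[OF total nb[OF that assms(2)]] .
  then show ?thesis
    using assms total_graph_adjD[OF total] by (cases v) auto
qed

lemma adj_base_move:
  assumes "v \<in> vertices" "s \<in> dirs m"
  shows "adj E s (base v) (base (move s v))"
proof (cases v)
  case (Mark x)
  then show ?thesis
    using assms mark[of x] by (auto simp: has_loops_def adj_def dirs_def)
qed (use assms total_graph_adjD(1)[OF total] nb in auto)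

lemma move_unique:
  assumes "adj edges s v w" "s \<in> determined v"
  shows "w = move s v"
  using assms unfolding adj_edges by (cases w) auto

lemma finite_vertices: "finite vertices"
proof (rule finite_subset)
  let ?Roots = "(\<lambda>(a, s, b). Root a s b) ` (V \<times> dirs m \<times> V)"
  let ?Cones = "(\<lambda>(a, t). Cone a t) ` (V \<times> insert None (Some ` dirs m))"
  show "vertices \<subseteq> ?Roots \<union> ?Cones \<union> Mark ` F"
  proof
    fix v assume v: "v \<in> vertices"
    show "v \<in> ?Roots \<union> ?Cones \<union> Mark ` F"
    proof (cases v)
      case (Root a s b)
      then have "(a, s, b) \<in> V \<times> dirs m \<times> V"
        using v total_graph_adjD[OF total] by auto
      then show ?thesis
        unfolding Root by (metis (no_types, lifting) UnI1 case_prod_conv image_eqI)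
    next
      case (Cone a t)
      then have "(a, t) \<in> V \<times> insert None (Some ` dirs m)"
        using v by (cases t) auto
      then show ?thesis
        unfolding Cone by blast
    next
      case (Mark x)
      then show ?thesis
        using v by simp
    qed
  qed
  show "finite (?Roots \<union> ?Cones \<union> Mark ` F)"
    using total finite_F finite_dirs by (simp add: total_graph_def)
qed

lemma total_cover: "total_graph m vertices edges"
  unfolding total_graph_def
proof (intro conjI ballI)
  show "edges \<subseteq> {..<m} \<times> vertices \<times> vertices"
    by (auto simp: edges_def)
  fix v s assume v: "v \<in> vertices" and s: "s \<in> dirs m"
  show "\<exists>w. adj edges s v w"
  proof (cases "s \<in> determined v")
    case True
    then show ?thesis
      using move_in_vertices v s unfolding adj_edges by blast
  next
    case False
    then obtain a where a: "v = Cone a (Some s)"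
      using s by (cases v) auto
    then obtain b where "adj E s a b"
      using total_graph_adjE[OF total _ s] v by auto
    then have "adj edges s v (Root b (opp s) a)"
      unfolding adj_edges using v s a by simp
    then show ?thesis
      by blast
  qed
qed (rule finite_vertices)

lemma base_vertices: "base ` vertices = V"
proof
  show "V \<subseteq> base ` vertices"
  proof
    fix a assume "a \<in> V"
    then have "Cone a None \<in> vertices"
      by simp
    then show "a \<in> base ` vertices"
      by (intro image_eqI[of _ base "Cone a None"]) simp_all
  qed
qed (use base_in_V in blast)

lemma edge_map_base: "edge_map base edges \<subseteq> E"
proof -
  have "(i, base v, base w) \<in> E" if "(i, v, w) \<in> edges" for i v w
  proof -
    have "i < m" "v \<in> vertices" "w \<in> vertices"
      using that by (auto simp: edges_def)
    then have "adj E (i, True) (base v) (base (move (i, True) v))"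
      "adj E (i, False) (base w) (base (move (i, False) w))"
      using adj_base_move by (auto simp: dirs_def)
    then show ?thesis
      using that by (auto simp: edges_def adj_def)
  qed
  then show ?thesis
    by (auto simp: edge_map_def)
qed

lemma has_loops_Mark: "x \<in> F \<Longrightarrow> has_loops m edges (Mark x)"
  by (simp add: has_loops_def edges_def dirs_def)

lemma branching_cover: "branching m (Mark ` F) edges"
  unfolding branching_def
proof (intro exI[of _ determined], unfold_locales)
  show "w = w'" if "s \<in> determined v" "adj edges s v w" "adj edges s v w'" for s v w w'
    using move_unique that by blast
  show "dirs m - determined w \<subseteq> {opp s}" if "s \<in> determined v" "adj edges s v w" for s v w
    using move_unique[OF that(2,1)] by (cases v) auto
  show "s \<in> determined v \<or> opp s \<in> determined w" if "adj edges s v w" for s v w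
    using that unfolding adj_edges by blast
  show "s = t" if "s \<in> dirs m - determined v" "t \<in> dirs m - determined v" for s t v
    using that by (cases v) auto
  show "dirs m \<subseteq> determined v" if "v \<in> Mark ` F" for v
    using that by auto
qed

end

lemma obtain_branching_cover:
  fixes E :: "'v edges" and mark :: "'p \<Rightarrow> 'v"
  assumes total: "total_graph m V E" and "finite F"
    and "\<And>x. x \<in> F \<Longrightarrow> mark x \<in> V \<and> has_loops m E (mark x)"
  obtains V' and E' :: "('v, 'p) cover edges" and \<delta> d where "total_graph m V' E'" "\<delta> ` V' = V"
    "edge_map \<delta> E' \<subseteq> E" "\<And>x. x \<in> F \<Longrightarrow> d x \<in> V' \<and> has_loops m E' (d x) \<and> \<delta> (d x) = mark x"
    "branching m (d ` F) E'"
proof -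
  define nb where "nb a s = (SOME b. adj E s a b)" for a s
  have "adj E s a (nb a s)" if "a \<in> V" "s \<in> dirs m" for a s
    unfolding nb_def by (rule someI_ex) (use total_graph_adjE[OF total that] in blast)
  then interpret marked_graph m V E F mark nb
    using assms by unfold_locales
  show ?thesis
    by (rule that[of vertices edges base Mark])
      (simp_all add: total_cover base_vertices edge_map_base has_loops_Mark branching_cover)
qed

section \<open>Tuples of homeomorphisms and their graphs\<close>

lemma nowhere_dense_in_complement:
  assumes "openin X U" "X closure_of U = topspace X"
  shows "nowhere_dense_in X (topspace X - U)"
proof -
  have "X closure_of (topspace X - U) = topspace X - U"
    using assms(1) by (simp add: closedin_diff closure_of_closedin)
  then show ?thesis
    using assms(2) by (simp add: nowhere_dense_in_def interior_of_complement)
qed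

lemma comeagre_inI:
  assumes "countable \<U>" and open_dense: "\<And>U. U \<in> \<U> \<Longrightarrow> openin X U \<and> X closure_of U = topspace X"
    and S: "S \<subseteq> topspace X" "topspace X \<inter> \<Inter>\<U> \<subseteq> S"
  shows "comeagre_in X S"
proof -
  let ?\<V> = "insert (topspace X) \<U>"
  define N where "N k = topspace X - from_nat_into ?\<V> k" for k
  have "nowhere_dense_in X (N k)" for k
  proof -
    have "from_nat_into ?\<V> k \<in> ?\<V>"
      by (rule from_nat_into) simp
    then show ?thesis
      unfolding N_def using open_dense by (intro nowhere_dense_in_complement) auto
  qed
  moreover have "topspace X - S \<subseteq> (\<Union>k. N k)"
  proof
    fix x assume x: "x \<in> topspace X - S"
    then obtain U where "U \<in> ?\<V>" "x \<notin> U"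
      using S(2) by blast
    moreover obtain k where "from_nat_into ?\<V> k = U"
      using from_nat_into_surj[of ?\<V> U] assms(1) \<open>U \<in> ?\<V>\<close> by auto
    ultimately show "x \<in> (\<Union>k. N k)"
      using x by (auto simp: N_def)
  qed
  ultimately show ?thesis
    using S(1) by (auto simp: comeagre_in_def meagre_in_def)
qed

definition induced :: "nat \<Rightarrow> (cantor \<Rightarrow> 'v) \<Rightarrow> (nat \<Rightarrow> cantor \<Rightarrow> cantor) \<Rightarrow> 'v edges" where
  "induced m \<rho> h = {(i, \<rho> y, \<rho> (h i y)) | i y. i < m}"

lemma induced_comp: "induced m (f \<circ> \<rho>) h = edge_map f (induced m \<rho> h)"
  by (force simp: induced_def edge_map_def)

lemma induced_cong:
  assumes "\<And>i. i < m \<Longrightarrow> \<rho> \<circ> h' i = \<rho> \<circ> h i"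
  shows "induced m \<rho> h' = induced m \<rho> h"
  using assms unfolding induced_def by (metis (no_types, lifting) comp_apply)

lemma induced_subset: "induced m \<rho> h \<subseteq> {..<m} \<times> range \<rho> \<times> range \<rho>"
  by (auto simp: induced_def)

lemma branching_induced_equivalent:
  assumes "branching m (\<rho> ` F) (induced m \<rho> h)" "determines \<sigma> \<rho>" "determines \<rho> \<sigma>"
  shows "branching m (\<sigma> ` F) (induced m \<sigma> h)"
proof -
  obtain f where f: "\<rho> = f \<circ> \<sigma>"
    using assms(2) by (auto simp: determines_iff_factor)
  show ?thesis
  proof (rule branching_if_inj_image)
    show "branching m (f ` \<sigma> ` F) (edge_map f (induced m \<sigma> h))"
      using assms(1) by (simp add: f image_comp induced_comp)
    show "inj_on f (range \<sigma>)"
      using determinesD[OF assms(3)] by (auto simp: f inj_on_def)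
  qed (rule induced_subset)
qed

locale marked_tuples =
  fixes F :: "cantor set" and m :: nat
  assumes finite_F: "finite F"
begin

abbreviation tuples :: "(nat \<Rightarrow> cantor \<Rightarrow> cantor) set" where
  "tuples \<equiv> {..<m} \<rightarrow>\<^sub>E fixing F"

abbreviation tuples_top :: "(nat \<Rightarrow> cantor \<Rightarrow> cantor) topology" where
  "tuples_top \<equiv> product_topology (\<lambda>_. subtopology Homeo_top (fixing F)) {..<m}"

definition nbhd :: "(nat \<Rightarrow> cantor \<Rightarrow> cantor) \<Rightarrow> nat \<Rightarrow> (nat \<Rightarrow> cantor \<Rightarrow> cantor) set" where
  "nbhd h k = {h' \<in> tuples. \<forall>i<m. h' i \<in> homeo_ball k (h i)}"

lemma topspace_tuples_top: "topspace tuples_top = tuples"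
  by (simp only: topspace_product_topology topspace_fixing_top)

lemma tuples_fixing: "h \<in> tuples \<Longrightarrow> i < m \<Longrightarrow> h i \<in> fixing F"
  by auto

lemma tuples_Homeo: "h \<in> tuples \<Longrightarrow> i < m \<Longrightarrow> h i \<in> Homeo"
  using tuples_fixing fixing_Homeo by blast

lemma tuples_mark: "h \<in> tuples \<Longrightarrow> i < m \<Longrightarrow> p \<in> F \<Longrightarrow> h i p = p"
  using tuples_fixing by (auto simp: fixing_def)

lemma nbhd_subset: "nbhd h k \<subseteq> tuples"
  by (auto simp: nbhd_def)

lemma self_in_nbhd: "h \<in> tuples \<Longrightarrow> h \<in> nbhd h k"
  using tuples_Homeo by (simp add: nbhd_def homeo_ball_def)

lemma openin_nbhd:
  assumes "h \<in> tuples"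
  shows "openin tuples_top (nbhd h k)"
proof -
  have "nbhd h k = Pi\<^sub>E {..<m} (\<lambda>i. homeo_ball k (h i) \<inter> fixing F)"
    unfolding nbhd_def by (intro set_eqI) (simp add: PiE_iff, blast)
  then show ?thesis
    using tuples_Homeo[OF assms] by (simp add: openin_PiE openin_homeo_ball openin_subtopology_Int)
qed

lemma openin_tuples_imp_nbhd:
  assumes "openin tuples_top S" "h \<in> S"
  obtains k where "nbhd h k \<subseteq> S"
proof -
  obtain U where U: "\<forall>i\<in>{..<m}. openin (subtopology Homeo_top (fixing F)) (U i)"
    "h \<in> Pi\<^sub>E {..<m} U" "Pi\<^sub>E {..<m} U \<subseteq> S"
    using assms unfolding openin_product_topology_alt by blast
  have "\<forall>\<^sub>F k in sequentially. \<forall>i\<in>{..<m}. homeo_ball k (h i) \<inter> fixing F \<subseteq> U i"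
  proof (intro eventually_ball_finite ballI)
    fix i assume i: "i \<in> {..<m}"
    then obtain W where W: "openin Homeo_top W" "U i = W \<inter> fixing F"
      using U(1) by (auto simp: openin_subtopology)
    have "h i \<in> W"
      using U(2) i W(2) by (auto simp: PiE_iff)
    then show "\<forall>\<^sub>F k in sequentially. homeo_ball k (h i) \<inter> fixing F \<subseteq> U i"
      unfolding W(2) by (intro eventually_mono[OF eventually_homeo_ball_subset[OF W(1)]]) blast+
  qed simp
  then obtain k where k: "\<And>i. i \<in> {..<m} \<Longrightarrow> homeo_ball k (h i) \<inter> fixing F \<subseteq> U i"
    by (auto simp: eventually_sequentially)
  have "nbhd h k \<subseteq> Pi\<^sub>E {..<m} U"
  proof
    fix h' assume h': "h' \<in> nbhd h k"
    have "h' i \<in> U i" if "i \<in> {..<m}" for i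
      using k[OF that] h' that by (auto simp: nbhd_def)
    then show "h' \<in> Pi\<^sub>E {..<m} U"
      using h' by (simp add: nbhd_def PiE_iff)
  qed
  then show ?thesis
    by (rule that[OF order_trans[OF _ U(3)]])
qed

lemma openin_tuplesI:
  assumes "S \<subseteq> tuples"
    and "\<And>h. h \<in> S \<Longrightarrow> \<exists>\<rho> :: cantor \<Rightarrow> 'v. locally_const \<rho> \<and>
      (\<forall>h'\<in>tuples. induced m \<rho> h' = induced m \<rho> h \<longrightarrow> h' \<in> S)"
  shows "openin tuples_top S"
proof (subst openin_subopen, intro ballI)
  fix h assume h: "h \<in> S"
  obtain \<rho> :: "cantor \<Rightarrow> 'v" and k where \<rho>: "determines (prefix_of k) \<rho>"
    "\<And>h'. h' \<in> tuples \<Longrightarrow> induced m \<rho> h' = induced m \<rho> h \<Longrightarrow> h' \<in> S"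
    using assms(2)[OF h] unfolding locally_const_def by blast
  have "nbhd h k \<subseteq> S"
  proof
    fix h' assume h': "h' \<in> nbhd h k"
    then have "induced m \<rho> h' = induced m \<rho> h"
      using \<rho>(1) by (intro induced_cong comp_eq_if_homeo_ball) (auto simp: nbhd_def)
    then show "h' \<in> S"
      using \<rho>(2) h' nbhd_subset by blast
  qed
  then show "\<exists>T. openin tuples_top T \<and> h \<in> T \<and> T \<subseteq> S"
    using h assms(1) openin_nbhd self_in_nbhd by (metis subsetD)
qed

lemma dense_tuplesI:
  assumes "\<And>h k. h \<in> tuples \<Longrightarrow> nbhd h k \<inter> S \<noteq> {}"
  shows "tuples_top closure_of S = topspace tuples_top"
  unfolding dense_intersects_open
proof (intro allI impI, elim conjE)
  fix W assume W: "openin tuples_top W" "W \<noteq> {}"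
  then obtain h where h: "h \<in> W"
    by blast
  then have "h \<in> tuples"
    using openin_subset[OF W(1)] unfolding topspace_tuples_top by blast
  moreover obtain k where "nbhd h k \<subseteq> W"
    using openin_tuples_imp_nbhd[OF W(1) h] .
  ultimately show "S \<inter> W \<noteq> {}"
    using assms by blast
qed

lemma total_induced:
  assumes h: "h \<in> tuples" and \<rho>: "locally_const \<rho>"
  shows "total_graph m (range \<rho>) (induced m \<rho> h)"
  unfolding total_graph_def
proof (intro conjI ballI)
  show "finite (range \<rho>)"
    using \<rho> by (rule finite_range_locally_const)
  show "induced m \<rho> h \<subseteq> {..<m} \<times> range \<rho> \<times> range \<rho>"
    by (rule induced_subset)
  fix a s assume "a \<in> range \<rho>" "s \<in> dirs m"
  then obtain y i b where y: "a = \<rho> y" "s = (i, b)" "i < m"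
    by (auto simp: dirs_def)
  obtain z where "h i z = y"
    using bij_if_Homeo[OF tuples_Homeo[OF h y(3)]] by (metis bij_pointE)
  then show "\<exists>b. adj (induced m \<rho> h) s a b"
    using y by (cases b) (auto simp: adj_def induced_def)
qed

lemma has_loops_induced:
  assumes "h \<in> tuples" "p \<in> F"
  shows "has_loops m (induced m \<rho> h) (\<rho> p)"
  unfolding has_loops_def
proof (intro allI impI)
  fix i assume i: "i < m"
  then have "(i, \<rho> p, \<rho> (h i p)) \<in> induced m \<rho> h"
    unfolding induced_def by blast
  then show "(i, \<rho> p, \<rho> p) \<in> induced m \<rho> h"
    using tuples_mark[OF assms(1) i assms(2)] by simp
qed

lemma realize_relation:
  assumes \<rho>: "locally_const \<rho>" and R: "finite R" "fst ` R = range \<rho>" "snd ` R = range \<rho>"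
    and marks: "\<And>p. p \<in> F \<Longrightarrow> (\<rho> p, \<rho> p) \<in> R"
  obtains g where "g \<in> fixing F" "range (\<lambda>y. (\<rho> y, \<rho> (g y))) = R"
proof -
  obtain u where u: "locally_const u" "range u = R" "fst \<circ> u = \<rho>" "\<And>p. p \<in> F \<Longrightarrow> u p = (\<rho> p, \<rho> p)"
    by (rule locally_const_lift[OF \<rho> finite_F R(1,2), of "\<lambda>p. (\<rho> p, \<rho> p)"]) (simp_all add: marks)
  obtain v where v: "locally_const v" "range v = R" "snd \<circ> v = \<rho>" "\<And>p. p \<in> F \<Longrightarrow> v p = (\<rho> p, \<rho> p)"
    by (rule locally_const_lift[OF \<rho> finite_F R(1,3), of "\<lambda>p. (\<rho> p, \<rho> p)"]) (simp_all add: marks)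
  have "compatible F u v"
    using u v by (simp add: compatible_def)
  then obtain g where g: "g \<in> fixing F" "v \<circ> g = u"
    by (rule fixing_homogeneous[OF finite_F])
  have "(\<rho> y, \<rho> (g y)) = u y" for y
    using u(3) v(3) g(2) by (metis comp_apply prod.collapse)
  then show ?thesis
    using that g(1) u(2) by simp
qed

lemma realize_graph:
  assumes \<rho>: "locally_const \<rho>" and E: "total_graph m (range \<rho>) E"
    and marks: "\<And>p. p \<in> F \<Longrightarrow> has_loops m E (\<rho> p)"
  obtains h where "h \<in> tuples" "induced m \<rho> h = E"
proof -
  define R where "R i = {(a, b). (i, a, b) \<in> E}" for i
  have "\<exists>g. g \<in> fixing F \<and> range (\<lambda>y. (\<rho> y, \<rho> (g y))) = R i" if i: "i < m" for i
  proof -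
    have "finite (R i)"
      by (rule finite_subset[of _ "range \<rho> \<times> range \<rho>"])
        (use E in \<open>auto simp: R_def total_graph_def\<close>)
    moreover have "(\<rho> p, \<rho> p) \<in> R i" if "p \<in> F" for p
      using marks[OF that] i by (simp add: R_def has_loops_def)
    ultimately obtain g where "g \<in> fixing F" "range (\<lambda>y. (\<rho> y, \<rho> (g y))) = R i"
      using realize_relation[OF \<rho> _ total_graph_relation[OF E i, folded R_def]] by blast
    then show ?thesis
      by blast
  qed
  then obtain g where g: "\<And>i. i < m \<Longrightarrow> g i \<in> fixing F"
    "\<And>i. i < m \<Longrightarrow> range (\<lambda>y. (\<rho> y, \<rho> (g i y))) = R i"
    by metis
  have "restrict g {..<m} \<in> tuples"
    using g(1) by simp
  moreover have "induced m \<rho> (restrict g {..<m}) = E"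
  proof (rule set_eqI)
    fix e :: "nat \<times> 'a \<times> 'a"
    obtain i a b where e: "e = (i, a, b)"
      by (cases e)
    have "e \<in> induced m \<rho> (restrict g {..<m}) \<longleftrightarrow> i < m \<and> (a, b) \<in> range (\<lambda>y. (\<rho> y, \<rho> (g i y)))"
      unfolding e induced_def by auto
    also have "\<dots> \<longleftrightarrow> i < m \<and> (i, a, b) \<in> E"
      using g(2)[of i] by (auto simp: R_def)
    also have "\<dots> \<longleftrightarrow> e \<in> E"
      unfolding e using E by (auto simp: total_graph_def)
    finally show "e \<in> induced m \<rho> (restrict g {..<m}) \<longleftrightarrow> e \<in> E" .
  qed
  ultimately show ?thesis
    by (rule that)
qed

definition resolves :: "(cantor \<Rightarrow> 'a) \<Rightarrow> (nat \<Rightarrow> cantor \<Rightarrow> cantor) \<Rightarrow> nat \<Rightarrow> bool" where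
  "resolves \<sigma> h k \<longleftrightarrow>
    determines \<sigma> (prefix_of k) \<and> (\<forall>i<m. determines \<sigma> (prefix_of k \<circ> h i))"

lemma eventually_resolves:
  assumes "h \<in> tuples"
  shows "\<forall>\<^sub>F l in sequentially. resolves (prefix_of l) h k"
proof -
  have "\<forall>\<^sub>F l in sequentially. \<forall>i\<in>{..<m}. determines (prefix_of l) (prefix_of k \<circ> h i)"
    using tuples_Homeo[OF assms]
    by (intro eventually_ball_finite ballI eventually_determines_prefix_of
        locally_const_comp_Homeo locally_const_prefix_of) auto
  moreover have "\<forall>\<^sub>F l in sequentially. determines (prefix_of l) (prefix_of k)"
    by (intro eventually_determines_prefix_of locally_const_prefix_of)
  ultimately show ?thesis
    by eventually_elim (simp add: resolves_def)
qed

lemma resolves_trans: "determines \<tau> \<sigma> \<Longrightarrow> resolves \<sigma> h k \<Longrightarrow> resolves \<tau> h k"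
  unfolding resolves_def using determines_trans by blast

lemma obtain_resolving_prefix:
  assumes "h \<in> tuples" "locally_const \<pi>"
  obtains l where "resolves (prefix_of l) h k" "determines (prefix_of l) \<pi>"
  using eventually_conj[OF eventually_resolves[OF assms(1), of k]
      eventually_determines_prefix_of[OF assms(2)]]
  by (auto simp: eventually_sequentially)

lemma prefix_eq_if_edge:
  assumes "resolves \<sigma> h k" "i < m" "(i, \<sigma> y, \<sigma> z) \<in> induced m \<sigma> h"
  shows "prefix_of k z = prefix_of k (h i y)"
proof -
  obtain w where w: "\<sigma> y = \<sigma> w" "\<sigma> z = \<sigma> (h i w)"
    using assms(3) by (auto simp: induced_def)
  have "prefix_of k z = prefix_of k (h i w)"
    using assms(1) w(2) determinesD unfolding resolves_def by metis
  also have "\<dots> = prefix_of k (h i y)"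
    using assms(1,2) w(1) determinesD unfolding resolves_def by (metis comp_apply)
  finally show ?thesis .
qed

lemma realize_near:
  assumes \<sigma>: "locally_const \<sigma>" "resolves \<sigma> h k"
    and E: "total_graph m V E" and \<delta>: "\<delta> ` V = range \<sigma>" "edge_map \<delta> E \<subseteq> induced m \<sigma> h"
    and d: "\<And>p. p \<in> F \<Longrightarrow> d p \<in> V \<and> has_loops m E (d p) \<and> \<delta> (d p) = \<sigma> p"
  obtains h' \<rho> where "h' \<in> nbhd h k" "locally_const \<rho>" "range \<rho> = V" "\<delta> \<circ> \<rho> = \<sigma>"
    "induced m \<rho> h' = E" "\<And>p. p \<in> F \<Longrightarrow> \<rho> p = d p"
proof -
  have "finite V"
    using E by (simp add: total_graph_def)
  then obtain \<rho> where \<rho>: "locally_const \<rho>" "range \<rho> = V" "\<delta> \<circ> \<rho> = \<sigma>" "\<And>p. p \<in> F \<Longrightarrow> \<rho> p = d p"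
    using locally_const_lift[OF \<sigma>(1) finite_F _ \<delta>(1), of d] d by metis
  obtain h' where h': "h' \<in> tuples" "induced m \<rho> h' = E"
    using realize_graph[OF \<rho>(1), of E] E \<rho>(2,4) d by metis
  have "prefix_of k (h' i y) = prefix_of k (h i y)" if "i < m" for i y
  proof (rule prefix_eq_if_edge[OF \<sigma>(2) that])
    have "(i, \<sigma> y, \<sigma> (h' i y)) \<in> induced m \<sigma> h'"
      using that by (auto simp: induced_def)
    also have "induced m \<sigma> h' = edge_map \<delta> E"
      using induced_comp[of m \<delta> \<rho> h'] \<rho>(3) h'(2) by simp
    finally show "(i, \<sigma> y, \<sigma> (h' i y)) \<in> induced m \<sigma> h"
      using \<delta>(2) by blast
  qed
  then have "h' \<in> nbhd h k"
    using h'(1) tuples_Homeo[OF h'(1)] by (auto simp: nbhd_def homeo_ball_def)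
  then show ?thesis
    using that \<rho> h'(2) by blast
qed

section \<open>Generic tuples\<close>

definition has_branching_refinement :: "nat \<Rightarrow> (nat \<Rightarrow> cantor \<Rightarrow> cantor) set" where
  "has_branching_refinement k = {h \<in> tuples. \<exists>\<rho> :: cantor \<Rightarrow> nat. locally_const \<rho> \<and>
     determines \<rho> (prefix_of k) \<and> branching m (\<rho> ` F) (induced m \<rho> h)}"

lemma has_branching_refinementI:
  fixes \<rho> :: "cantor \<Rightarrow> 'v"
  assumes "h \<in> tuples" and \<rho>: "locally_const \<rho>" "determines \<rho> (prefix_of k)"
    "branching m (\<rho> ` F) (induced m \<rho> h)"
  shows "h \<in> has_branching_refinement k"
proof -
  define c where "c = to_nat_on (range \<rho>)"
  have c: "inj_on c (range \<rho>)"
    unfolding c_def by (intro inj_on_to_nat_on countable_finite finite_range_locally_const \<rho>(1))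
  have equiv: "determines (c \<circ> \<rho>) \<rho>" "determines \<rho> (c \<circ> \<rho>)"
    using c
    by (auto intro!: determinesI[of _ "inv_into (range \<rho>) c"] determines_comp simp: fun_eq_iff)
  show ?thesis
    unfolding has_branching_refinement_def
  proof (intro CollectI conjI exI[of _ "c \<circ> \<rho>"])
    show "determines (c \<circ> \<rho>) (prefix_of k)"
      using equiv(1) \<rho>(2) by (rule determines_trans)
    show "branching m ((c \<circ> \<rho>) ` F) (induced m (c \<circ> \<rho>) h)"
      using \<rho>(3) equiv by (rule branching_induced_equivalent)
  qed (use assms(1) locally_const_comp[OF \<rho>(1)] in auto)
qed

lemma open_has_branching_refinement: "openin tuples_top (has_branching_refinement k)"
proof (rule openin_tuplesI)
  show "has_branching_refinement k \<subseteq> tuples"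
    by (auto simp: has_branching_refinement_def)
  fix h assume "h \<in> has_branching_refinement k"
  then obtain \<rho> :: "cantor \<Rightarrow> nat" where \<rho>: "locally_const \<rho>" "determines \<rho> (prefix_of k)"
    "branching m (\<rho> ` F) (induced m \<rho> h)"
    by (auto simp: has_branching_refinement_def)
  then have "h' \<in> has_branching_refinement k"
    if "h' \<in> tuples" "induced m \<rho> h' = induced m \<rho> h" for h'
    using that by (intro has_branching_refinementI[of h' \<rho>]) simp_all
  then show "\<exists>\<rho> :: cantor \<Rightarrow> nat. locally_const \<rho> \<and>
      (\<forall>h'\<in>tuples. induced m \<rho> h' = induced m \<rho> h \<longrightarrow> h' \<in> has_branching_refinement k)"
    using \<rho>(1) by blast
qed

lemma dense_has_branching_refinement:
  "tuples_top closure_of has_branching_refinement r = topspace tuples_top"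
proof (rule dense_tuplesI)
  fix h k assume h: "h \<in> tuples"
  obtain l where l: "resolves (prefix_of l) h k" "determines (prefix_of l) (prefix_of r)"
    using obtain_resolving_prefix[OF h locally_const_prefix_of] .
  have prefix: "locally_const (prefix_of l)"
    by (rule locally_const_prefix_of)
  obtain V and E :: "(bool list, cantor) cover edges" and \<delta> d where cover: "total_graph m V E"
    "\<delta> ` V = range (prefix_of l)" "edge_map \<delta> E \<subseteq> induced m (prefix_of l) h"
    "\<And>p. p \<in> F \<Longrightarrow> d p \<in> V \<and> has_loops m E (d p) \<and> \<delta> (d p) = prefix_of l p"
    "branching m (d ` F) E"
    using obtain_branching_cover[OF total_induced[OF h prefix] finite_F, of "prefix_of l"]
      has_loops_induced[OF h] by (metis rangeI)
  obtain h' \<rho> where h': "h' \<in> nbhd h k" and \<rho>: "locally_const \<rho>" "range \<rho> = V" "\<delta> \<circ> \<rho> = prefix_of l"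
    "induced m \<rho> h' = E" "\<And>p. p \<in> F \<Longrightarrow> \<rho> p = d p"
    using realize_near[OF prefix l(1) cover(1-4)] by metis
  have "h' \<in> has_branching_refinement r"
  proof (rule has_branching_refinementI)
    show "h' \<in> tuples"
      using h' nbhd_subset by blast
    have "determines \<rho> (prefix_of l)"
      unfolding \<rho>(3)[symmetric] by (rule determines_comp)
    then show "determines \<rho> (prefix_of r)"
      using l(2) by (rule determines_trans)
    have "\<rho> ` F = d ` F"
      using \<rho>(5) by (rule image_cong[OF refl])
    then show "branching m (\<rho> ` F) (induced m \<rho> h')"
      using cover(5) \<rho>(4) by simp
  qed (rule \<rho>(1))
  then show "nbhd h k \<inter> has_branching_refinement r \<noteq> {}"
    using h' by blast
qed

text \<open>The cells of a refinement are numbered by \<open>prod_encode (a, b)\<close> with \<open>a\<close> the number of the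
  coarser cell. With this fixed projection the extension conditions form a countable family.\<close>
definition coarsen :: "nat \<Rightarrow> nat" where
  "coarsen = fst \<circ> prod_decode"

definition extension_problem ::
    "(cantor \<Rightarrow> nat) \<Rightarrow> (cantor \<Rightarrow> nat) \<Rightarrow> nat edges \<Rightarrow> (nat \<Rightarrow> cantor \<Rightarrow> cantor) \<Rightarrow> bool" where
  "extension_problem \<pi> u E h \<longleftrightarrow> compatible F (coarsen \<circ> u) \<pi> \<and> (\<exists>h0\<in>tuples. induced m u h0 = E) \<and>
     edge_map coarsen E = induced m \<pi> h \<and> branching m (\<pi> ` F) (induced m \<pi> h)"

definition extension :: "(cantor \<Rightarrow> nat) \<Rightarrow> (cantor \<Rightarrow> nat) \<Rightarrow> nat edges \<Rightarrow>
    (nat \<Rightarrow> cantor \<Rightarrow> cantor) \<Rightarrow> (cantor \<Rightarrow> nat) \<Rightarrow> bool" where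
  "extension \<pi> u E h v \<longleftrightarrow> compatible F u v \<and> coarsen \<circ> v = \<pi> \<and> induced m v h = E"

definition has_extension ::
    "(cantor \<Rightarrow> nat) \<Rightarrow> (cantor \<Rightarrow> nat) \<Rightarrow> nat edges \<Rightarrow> (nat \<Rightarrow> cantor \<Rightarrow> cantor) set" where
  "has_extension \<pi> u E = {h \<in> tuples. extension_problem \<pi> u E h \<longrightarrow> (\<exists>v. extension \<pi> u E h v)}"

lemma open_has_extension:
  assumes "locally_const \<pi>"
  shows "openin tuples_top (has_extension \<pi> u E)"
proof (rule openin_tuplesI)
  show "has_extension \<pi> u E \<subseteq> tuples"
    by (auto simp: has_extension_def)
  fix h assume "h \<in> has_extension \<pi> u E"
  then consider (extended) v where "extension \<pi> u E h v"
    | (no_problem) "\<not> extension_problem \<pi> u E h"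
    by (auto simp: has_extension_def)
  then show "\<exists>\<rho> :: cantor \<Rightarrow> nat. locally_const \<rho> \<and>
      (\<forall>h'\<in>tuples. induced m \<rho> h' = induced m \<rho> h \<longrightarrow> h' \<in> has_extension \<pi> u E)"
  proof cases
    case extended
    then show ?thesis
      by (intro exI[of _ v]) (auto simp: has_extension_def extension_def compatible_def)
  next
    case no_problem
    then have "\<not> extension_problem \<pi> u E h'" if "induced m \<pi> h' = induced m \<pi> h" for h'
      using that by (simp add: extension_problem_def)
    then show ?thesis
      using assms by (auto simp: has_extension_def)
  qed
qed

lemma branching_cospan_induced:
  assumes T: "branch_system m (\<pi> ` F) (induced m \<pi> h) T" and h: "h \<in> tuples" "h0 \<in> tuples"
    and u: "locally_const u" and \<sigma>: "locally_const \<sigma>" and \<pi>: "\<pi> = \<psi> \<circ> \<sigma>"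
    and range: "range (\<phi> \<circ> u) = range \<pi>" and hom: "induced m (\<phi> \<circ> u) h0 = induced m \<pi> h"
  shows "branching_cospan m (\<pi> ` F) (induced m \<pi> h) T (range u) (induced m u h0) \<phi>
    (range \<sigma>) (induced m \<sigma> h) \<psi>"
proof (intro branching_cospan.intro branching_cospan_axioms.intro)
  show "total_graph m (range u) (induced m u h0)"
    using h(2) u by (rule total_induced)
  show "total_graph m (range \<sigma>) (induced m \<sigma> h)"
    using h(1) \<sigma> by (rule total_induced)
  show "edge_map \<phi> (induced m u h0) \<subseteq> induced m \<pi> h"
    by (simp add: hom flip: induced_comp)
  show "edge_map \<psi> (induced m \<sigma> h) \<subseteq> induced m \<pi> h"
    by (simp add: \<pi> induced_comp)
  show "\<phi> ` range u = \<psi> ` range \<sigma>"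
    using range by (simp add: \<pi> image_comp)
qed (rule T)

lemma extension_near:
  assumes \<pi>: "locally_const \<pi>" and u: "locally_const u" and h: "h \<in> tuples"
    and problem: "extension_problem \<pi> u E h"
  obtains h' v where "h' \<in> nbhd h k" "extension \<pi> u E h' v"
proof -
  obtain h0 T where h0: "h0 \<in> tuples" "E = induced m u h0" and u_\<pi>: "compatible F (coarsen \<circ> u) \<pi>"
    and hom: "edge_map coarsen E = induced m \<pi> h" and T: "branch_system m (\<pi> ` F) (induced m \<pi> h) T"
    using problem by (auto simp: extension_problem_def branching_def)
  obtain l where l: "resolves (prefix_of l) h k" "determines (prefix_of l) \<pi>"
    using obtain_resolving_prefix[OF h \<pi>] .
  obtain \<psi> where \<psi>: "\<pi> = \<psi> \<circ> prefix_of l"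
    using l(2) by (auto simp: determines_iff_factor)
  interpret branching_cospan m "\<pi> ` F" "induced m \<pi> h" T "range u" "induced m u h0" coarsen
    "range (prefix_of l)" "induced m (prefix_of l) h" \<psi>
    using u_\<pi> hom h0(2)
    by (intro branching_cospan_induced[OF T h h0(1) u locally_const_prefix_of \<psi>])
      (simp_all add: compatible_def induced_comp)
  have marks: "(u p, prefix_of l p) \<in> core \<and> has_loops m core_edges (u p, prefix_of l p)"
    if p: "p \<in> F" for p
  proof -
    have "coarsen (u p) = \<psi> (prefix_of l p)" "coarsen (u p) \<in> \<pi> ` F"
      using u_\<pi> p by (auto simp: compatible_def \<psi>)
    then have "(u p, prefix_of l p) \<in> core"
      by (intro core_mark) auto
    then show ?thesis
      using has_loops_core has_loops_induced[OF h0(1) p] has_loops_induced[OF h p] by blast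
  qed
  obtain h' \<rho> where h': "h' \<in> nbhd h k" and \<rho>: "locally_const \<rho>" "range \<rho> = core"
    "snd \<circ> \<rho> = prefix_of l" "induced m \<rho> h' = core_edges" "\<And>p. p \<in> F \<Longrightarrow> \<rho> p = (u p, prefix_of l p)"
    by (rule realize_near[OF locally_const_prefix_of l(1) total_core snd_core edge_map_snd_core,
          of "\<lambda>p. (u p, prefix_of l p)"]) (simp_all add: marks)
  have "range (fst \<circ> \<rho>) = range u"
    using \<rho>(2) fst_core by (metis image_comp)
  then have "compatible F u (fst \<circ> \<rho>)"
    using u locally_const_comp[OF \<rho>(1)] \<rho>(5) by (simp add: compatible_def)
  moreover have "coarsen (fst (\<rho> y)) = \<psi> (snd (\<rho> y))" for y
    using coreD(3)[of "fst (\<rho> y)" "snd (\<rho> y)"] \<rho>(2) by auto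
  then have "coarsen \<circ> (fst \<circ> \<rho>) = \<pi>"
    unfolding \<psi> \<rho>(3)[symmetric] by auto
  moreover have "induced m (fst \<circ> \<rho>) h' = E"
    by (simp add: induced_comp \<rho>(4) edge_map_fst_core h0(2))
  ultimately have "extension \<pi> u E h' (fst \<circ> \<rho>)"
    by (simp add: extension_def)
  with h' show ?thesis
    by (rule that)
qed

lemma dense_has_extension:
  assumes "locally_const \<pi>" "locally_const u"
  shows "tuples_top closure_of has_extension \<pi> u E = topspace tuples_top"
proof (rule dense_tuplesI)
  fix h k assume h: "h \<in> tuples"
  show "nbhd h k \<inter> has_extension \<pi> u E \<noteq> {}"
  proof (cases "extension_problem \<pi> u E h")
    case True
    then obtain h' v where "h' \<in> nbhd h k" "extension \<pi> u E h' v"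
      using extension_near[OF assms h] by blast
    then have "h' \<in> nbhd h k \<inter> has_extension \<pi> u E"
      using nbhd_subset by (auto simp: has_extension_def)
    then show ?thesis
      by blast
  next
    case False
    then have "h \<in> nbhd h k \<inter> has_extension \<pi> u E"
      using h self_in_nbhd by (auto simp: has_extension_def)
    then show ?thesis
      by blast
  qed
qed

definition generic_set :: "(nat \<Rightarrow> cantor \<Rightarrow> cantor) set" where
  "generic_set = {h \<in> tuples. (\<forall>k. h \<in> has_branching_refinement k) \<and>
     (\<forall>\<pi> u E. locally_const \<pi> \<longrightarrow> locally_const u \<longrightarrow> finite E \<longrightarrow> h \<in> has_extension \<pi> u E)}"

lemma comeagre_if_superset_generic_set:
  assumes "generic_set \<subseteq> S" "S \<subseteq> tuples"
  shows "comeagre_in tuples_top S"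
proof (rule comeagre_inI)
  let ?LC = "{\<rho> :: cantor \<Rightarrow> nat. locally_const \<rho>}"
  let ?I = "?LC \<times> ?LC \<times> {E :: nat edges. finite E}"
  let ?\<U> = "range has_branching_refinement \<union> (\<lambda>(\<pi>, u, E). has_extension \<pi> u E) ` ?I"
  show "countable ?\<U>"
    by (intro countable_Un countable_image countable_SIGMA countable_locally_const
        countable_Collect_finite countableI_type)
  show "openin tuples_top U \<and> tuples_top closure_of U = topspace tuples_top" if "U \<in> ?\<U>" for U
    using that open_has_branching_refinement dense_has_branching_refinement
      open_has_extension dense_has_extension by auto
  show "S \<subseteq> topspace tuples_top"
    unfolding topspace_tuples_top by (rule assms(2))
  have "topspace tuples_top \<inter> \<Inter> ?\<U> \<subseteq> generic_set"
    unfolding topspace_tuples_top generic_set_def by fast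
  then show "topspace tuples_top \<inter> \<Inter> ?\<U> \<subseteq> S"
    using assms(1) by (rule order_trans)
qed

definition matching :: "(nat \<Rightarrow> cantor \<Rightarrow> cantor) \<Rightarrow> (nat \<Rightarrow> cantor \<Rightarrow> cantor) \<Rightarrow>
    (cantor \<Rightarrow> nat) \<Rightarrow> (cantor \<Rightarrow> nat) \<Rightarrow> bool" where
  "matching h h' u v \<longleftrightarrow> compatible F u v \<and> induced m u h = induced m v h' \<and>
     branching m (u ` F) (induced m u h)"

lemma matching_sym:
  assumes "matching h h' u v"
  shows "matching h' h v u"
proof -
  have "u ` F = v ` F"
    using assms by (intro image_cong) (auto simp: matching_def compatible_def)
  then show ?thesis
    using assms compatible_sym unfolding matching_def by metis
qed

lemma matching_const: "matching h h' (\<lambda>_. c) (\<lambda>_. c)"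
proof -
  have "branch_system m ((\<lambda>_. c) ` F) (induced m (\<lambda>_. c) h) (\<lambda>_. dirs m)"
    by unfold_locales (auto simp: adj_def induced_def dirs_def split: if_splits)
  then show ?thesis
    by (auto simp: matching_def compatible_def locally_const_const induced_def branching_def)
qed

lemma generic_branching_refinement:
  assumes h: "h \<in> generic_set" and u: "locally_const u"
  obtains u' where "locally_const u'" "coarsen \<circ> u' = u" "determines u' (prefix_of k)"
    "branching m (u' ` F) (induced m u' h)"
proof -
  obtain l where l: "determines (prefix_of l) u" "determines (prefix_of l) (prefix_of k)"
    using common_determining_prefix[OF u locally_const_prefix_of] .
  have "h \<in> has_branching_refinement l"
    using h by (simp add: generic_set_def)
  then obtain \<rho> :: "cantor \<Rightarrow> nat" where \<rho>: "locally_const \<rho>" "determines \<rho> (prefix_of l)"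
    "branching m (\<rho> ` F) (induced m \<rho> h)"
    by (auto simp: has_branching_refinement_def)
  define u' where "u' = prod_encode \<circ> (\<lambda>y. (u y, \<rho> y))"
  have "determines \<rho> (\<lambda>y. (u y, \<rho> y))"
    using determines_trans[OF \<rho>(2) l(1)] determines_refl by (rule determines_pair)
  then have \<rho>_u': "determines \<rho> u'"
    unfolding u'_def using determines_comp by (rule determines_trans)
  have u'_\<rho>: "determines u' \<rho>"
    by (rule determinesI[of _ "snd \<circ> prod_decode"]) (auto simp: u'_def)
  show ?thesis
  proof (rule that)
    show "locally_const u'" "coarsen \<circ> u' = u"
      unfolding u'_def
      by (intro locally_const_comp locally_const_pair u \<rho>(1)) (auto simp: coarsen_def)
    show "determines u' (prefix_of k)"
      using u'_\<rho> determines_trans[OF \<rho>(2) l(2)] by (rule determines_trans)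
    show "branching m (u' ` F) (induced m u' h)"
      using \<rho>(3) u'_\<rho> \<rho>_u' by (rule branching_induced_equivalent)
  qed
qed

lemma matching_forth:
  assumes h: "h \<in> generic_set" and h': "h' \<in> generic_set" and uv: "matching h h' u v"
  shows "\<exists>u' v'. matching h h' u' v' \<and> coarsen \<circ> u' = u \<and> coarsen \<circ> v' = v \<and>
    determines u' (prefix_of k)"
proof -
  have u: "locally_const u" and v: "locally_const v"
    using uv by (auto simp: matching_def compatible_def)
  obtain u' where u': "locally_const u'" "coarsen \<circ> u' = u" "determines u' (prefix_of k)"
    "branching m (u' ` F) (induced m u' h)"
    using generic_branching_refinement[OF h u] .
  have "h \<in> tuples"
    using h by (simp add: generic_set_def)
  then have "extension_problem v u' (induced m u' h) h'"
    using uv matching_sym[OF uv] u'(2)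
    by (auto simp: extension_problem_def matching_def simp flip: induced_comp)
  moreover have "finite (induced m u' h)"
    by (rule finite_subset[OF induced_subset]) (simp add: finite_range_locally_const u'(1))
  then have "h' \<in> has_extension v u' (induced m u' h)"
    using h' v u'(1) by (simp add: generic_set_def)
  ultimately obtain v' where "extension v u' (induced m u' h) h' v'"
    by (auto simp: has_extension_def)
  then have "matching h h' u' v'" "coarsen \<circ> v' = v"
    using u'(4) by (auto simp: extension_def matching_def)
  then show ?thesis
    using u'(2,3) by blast
qed

lemma conjugates_if_matching_limit:
  assumes h: "h \<in> tuples" and g: "g \<in> Homeo" and i: "i < m"
    and limit: "\<And>k. \<exists>u v. matching h h' u v \<and> determines u (prefix_of k) \<and> v \<circ> g = u"
  shows "h' i \<circ> g = g \<circ> h i"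
proof
  fix y
  obtain w where w: "g w = h' i (g y)"
    using bij_if_Homeo[OF g] by (metis bij_pointE)
  have "prefix_of k w = prefix_of k (h i y)" for k
  proof -
    obtain l where "resolves (prefix_of l) h k"
      using eventually_resolves[OF h] by (auto simp: eventually_sequentially)
    moreover obtain u v where uv: "matching h h' u v" "determines u (prefix_of l)" "v \<circ> g = u"
      using limit by blast
    ultimately have "resolves u h k"
      using resolves_trans by blast
    moreover have "(i, v (g y), v (h' i (g y))) \<in> induced m v h'"
      using i by (auto simp: induced_def)
    then have "(i, (v \<circ> g) y, (v \<circ> g) w) \<in> induced m u h"
      using uv(1) by (simp add: w matching_def)
    then have "(i, u y, u w) \<in> induced m u h"
      by (simp only: uv(3))
    ultimately show ?thesis
      by (rule prefix_eq_if_edge[OF _ i])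
  qed
  then have "w = h i y"
    by (rule eq_if_prefixes_eq)
  then show "(h' i \<circ> g) y = (g \<circ> h i) y"
    using w by simp
qed

lemma generic_conjugate:
  assumes h: "h \<in> generic_set" and h': "h' \<in> generic_set"
  obtains g where "g \<in> fixing F" "\<And>i. i < m \<Longrightarrow> h' i \<circ> g = g \<circ> h i"
proof -
  have matching_back: "\<exists>u' v'. matching h h' u' v' \<and> coarsen \<circ> u' = u \<and> coarsen \<circ> v' = v \<and>
      determines v' (prefix_of k)" if "matching h h' u v" for u v k
    using matching_forth[OF h' h matching_sym[OF that]] matching_sym by blast
  have matching_compatible: "compatible F u v" if "matching h h' u v" for u v
    using that by (simp add: matching_def)
  obtain g where g: "g \<in> fixing F"
    "\<forall>k. \<exists>u v. matching h h' u v \<and> determines u (prefix_of k) \<and> v \<circ> g = u"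
    by (rule back_and_forth[of "matching h h'", OF matching_const[of h h' 0] matching_compatible
          matching_forth[OF h h'] matching_back]) blast
  have "h \<in> tuples"
    using h by (simp add: generic_set_def)
  then have "h' i \<circ> g = g \<circ> h i" if "i < m" for i
    using fixing_Homeo[OF g(1)] that g(2) by (intro conjugates_if_matching_limit) blast+
  with g(1) show ?thesis
    by (rule that)
qed

lemma conj_orbit_subset:
  assumes "h \<in> tuples"
  shows "conj_orbit (fixing F) m h \<subseteq> tuples"
  using fixing_conj tuples_fixing[OF assms] by (auto simp: conj_orbit_def)

lemma generic_set_subset_conj_orbit:
  assumes h: "h \<in> generic_set"
  shows "generic_set \<subseteq> conj_orbit (fixing F) m h"
proof
  fix f assume f: "f \<in> generic_set"
  obtain g where g: "g \<in> fixing F" "\<And>i. i < m \<Longrightarrow> h i \<circ> g = g \<circ> f i"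
    using generic_conjugate[OF f h] by blast
  have "inv g \<circ> g = id"
    using bij_if_Homeo[OF fixing_Homeo[OF g(1)]] by (simp add: bij_is_inj)
  then have "inv g \<circ> h i \<circ> g = f i" if "i < m" for i
    using g(2)[OF that] by (metis comp_assoc id_comp)
  moreover have "f \<in> extensional {..<m}"
    using f by (simp add: generic_set_def PiE_def)
  ultimately have "f = (\<lambda>i\<in>{..<m}. inv g \<circ> h i \<circ> g)"
    by (intro extensionalityI[of _ "{..<m}"]) auto
  then show "f \<in> conj_orbit (fixing F) m h"
    using g(1) by (auto simp: conj_orbit_def)
qed

lemma generic_tuple_exists: "\<exists>h. generic_tuple (fixing F) (subtopology Homeo_top (fixing F)) m h"
proof -
  \<comment> \<open>If \<open>generic_set\<close> were empty, the empty set and hence every orbit would be comeagre.\<close>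
  obtain h where h: "h \<in> tuples" "generic_set \<subseteq> conj_orbit (fixing F) m h"
  proof (cases "generic_set = {}")
    case True
    moreover have "(\<lambda>i\<in>{..<m}. id) \<in> tuples"
      by (simp add: id_in_fixing)
    ultimately show ?thesis
      using that by blast
  next
    case False
    then obtain h where "h \<in> generic_set"
      by blast
    moreover have "h \<in> tuples"
      using \<open>h \<in> generic_set\<close> by (simp add: generic_set_def)
    ultimately show ?thesis
      using that generic_set_subset_conj_orbit by blast
  qed
  then have "comeagre_in tuples_top (conj_orbit (fixing F) m h)"
    using conj_orbit_subset by (intro comeagre_if_superset_generic_set)
  then show ?thesis
    using h(1) unfolding generic_tuple_def topspace_tuples_top by blast
qed

end

lemma ample_generics_fixing:
  assumes "finite F"
  shows "ample_generics (fixing F) (subtopology Homeo_top (fixing F))"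
  unfolding ample_generics_def
proof
  fix m
  interpret marked_tuples F m
    using assms by unfold_locales
  show "\<exists>h. generic_tuple (fixing F) (subtopology Homeo_top (fixing F)) m h"
    by (rule generic_tuple_exists)
qed

theorem theorem1p2:
  fixes n :: nat and x :: "nat \<Rightarrow> (nat \<Rightarrow> bool)"
  assumes "inj_on x {1..n}"
  shows "ample_generics (Stab n x) (Stab_top n x)"
proof -
  have "Stab n x = fixing (x ` {1..n})"
    by (auto simp: Stab_def fixing_def)
  then show ?thesis
    unfolding Stab_top_def by (simp add: ample_generics_fixing)
qed

end
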